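(* Let $m,n\in\mathbb{N}_0$ with $m+n>1$, let $\Theta=\{\theta_{ij}\in\mathbb{R}:1\le i<j\le m+n\}$, and let $\pi:B_\Theta^{m,n}\to\mathcal{L}(\mathcal{H})$ be a unital representation. With $\mathcal{P},\mathcal{H}_0,K,u_i,\mathcal{P}_i$ as defined in the context, the following hold. (i) $\pi(s_1\cdots s_{m+n})|_{\mathcal{H}_0}$ is a unitary and $\pi(s_1\cdots s_{m+n})|_K\simeq S^*\otimes1$ under the identification $K\simeq\ell^2(\mathbb{N}_0)\otimes\mathcal{P}\mathcal{H}$. (ii) For $1\le i\le m+n$, $\pi(s_i)|_{\mathcal{H}_0}$ is a unitary operator. (iii) The defect projection $\mathcal{P}$ of $\pi(s_1s_2\cdots s_{m+n})$ commutes with the elements $u_i'=\pi(u_i)$ and $\mathcal{P}_i'=\pi(\mathcal{P}_i)$ for $1\le i\le m+n$. The operators $u_i'$ and $\mathcal{P}_i'$ are unitary operators and projection operators, respectively, on $\mathcal{P}\mathcal{H}$. (iv) Under the identification of $K$ with $\ell^2(\mathbb{N}_0)\otimes\mathcal{P}\mathcal{H}$, one has $$\pi(s_k)|_K=\begin{cases}\prod_{i=1}^{k-1}(\lambda_{ik}^N)^*\prod_{i=k+1}^{m+n}\lambda_{ki}^N\otimes u_k'&\text{if }1\le k\le m,\\[6pt] \prod_{i=1}^{k-1}\overline{\lambda_{ik}}\,S^*\prod_{i=1}^{k-1}(\lambda_{ik}^N)^*\prod_{i=k+1}^{m+n}\lambda_{ki}^N\otimes u_k'\mathcal{P}_k'+\prod_{i=1}^{k-1}(\lambda_{ik}^N)^*\prod_{i=k+1}^{m+n}\lambda_{ki}^N\otimes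 u_k'(1-\mathcal{P}_k')&\text{if }m+1\le k\le m+n,\end{cases}$$ where $\lambda_{ij}=e^{2\pi \mathrm{i}\theta_{ij}}$ for $i<j$ and $\lambda^N$ is the operator on $\ell^2(\mathbb{N}_0)$ given by $\lambda^N e_l=\lambda^l e_l$.
   Context: $\mathbb{N}_0=\mathbb{N}\cup\{0\}$; $\{e_l\}_{l\in\mathbb{N}_0}$ is the standard orthonormal basis of $\ell^2(\mathbb{N}_0)$; $S$ is the shift $e_l\mapsto e_{l-1}$ ($e_0\mapsto0$), so $S^*e_l=e_{l+1}$. All algebras and Hilbert spaces are separable and over $\mathbb{C}$. $B_\Theta^{m,n}$ is the universal (unital) $C^*$-algebra generated by $s_1,\dots,s_{m+n}$ subject to $s_is_j=e^{2\pi \mathrm{i}\theta_{ij}}s_js_i$ for $1\le i<j\le m+n$, $s_i^*s_i=1$ for $1\le i\le m+n$, and $s_is_i^*=1$ for $1\le i\le m$. Let $\alpha=\pi(s_1\cdots s_{m+n})$ and let $\mathcal{P}=1-\alpha\alpha^*=1-\pi(s_{m+1}\cdots s_{m+n}s_{m+n}^*\cdots s_{m+1}^* )$ be the defect projection of $\alpha$. Define $\mathcal{H}_0=\{h\in\mathcal{H}:\text{for every }k>0\text{ there exists }h_k\in\mathcal{H}\text{ with }h=\alpha^kh_k\}$ and let $K$ be the closed linear span of $\{\alpha^k\eta:k\ge0,\ \eta\in\mathcal{P}\mathcal{H}\}$. Then $\mathcal{H}_0$ and $K$ are closed reducing subspaces, $\mathcal{H}_0^\perp=K$, and $K\simeq\ell^2(\mathbb{N}_0)\otimes\mathcal{P}\mathcal{H}$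 via $\alpha^l\eta\mapsto e_l\otimes\eta$. For $1\le i\le m+n$ let $Q_i=s_{m+1}\cdots\widehat{s_i}\cdots s_{m+n}$ be the product of $s_{m+1},\dots,s_{m+n}$ in increasing order with $s_i$ omitted (so nothing is omitted if $i\le m$), and define $$u_i=s_i(1-Q_iQ_i^* )+(1-s_is_i^* )Q_i^*,\qquad \mathcal{P}_i=Q_i(1-s_is_i^* )Q_i^*.$$
   Formalization: In the second case of (iv), Q_k in u_k and P_k is taken as the product of all s_1,…,s_{m+n} except s_k; with the printed Q_k (from s_{m+1} on) the formula fails for m≥1, e.g. m=n=1, θ=0, π(s_1)=−1, π(s_2) the unilateral shift. *)

theory Defs
  imports "HOL-Analysis.Analysis" "HOL-Algebra.Module"
begin

section \<open>Complex Hilbert spaces\<close>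

text \<open>
  The norm, metric and topology are those of \<^class>\<open>real_inner\<close>, whose real inner product is
  the real part of the complex one. The complex inner product is linear in the first argument.
\<close>

class complex_inner = real_inner +
  fixes scaleC :: "complex \<Rightarrow> 'a \<Rightarrow> 'a" (infixr "*\<^sub>C" 75)
    and cinner :: "'a \<Rightarrow> 'a \<Rightarrow> complex"
  assumes scaleC_add_right: "c *\<^sub>C (x + y) = c *\<^sub>C x + c *\<^sub>C y"
    and scaleC_add_left: "(c + d) *\<^sub>C x = c *\<^sub>C x + d *\<^sub>C x"
    and scaleC_scaleC: "c *\<^sub>C d *\<^sub>C x = (c * d) *\<^sub>C x"
    and scaleR_scaleC: "r *\<^sub>R x = complex_of_real r *\<^sub>C x"
    and cinner_commute: "cinner x y = cnj (cinner y x)"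
    and cinner_add_left: "cinner (x + y) z = cinner x z + cinner y z"
    and cinner_scaleC_left: "cinner (c *\<^sub>C x) y = c * cinner x y"
    and inner_Re: "inner x y = Re (cinner x y)"

class complex_hilbert = complex_inner + complete_space

lemma scaleC_one: "1 *\<^sub>C x = (x::'a::complex_inner)"
  using scaleR_scaleC[of 1 x] by simp

global_interpretation complex_vector: vector_space "scaleC :: complex \<Rightarrow> 'a \<Rightarrow> 'a::complex_inner"
  defines csubspace = complex_vector.subspace
    and cspan = complex_vector.span
  by unfold_locales (simp_all add: scaleC_add_right scaleC_add_left scaleC_scaleC scaleC_one)

lemma cinner_add_right: "cinner z (x + y) = cinner z x + cinner z (y::'a::complex_inner)"
  by (metis cinner_add_left cinner_commute complex_cnj_add)

lemma cinner_scaleC_right: "cinner y (c *\<^sub>C x) = cnj c * cinner y (x::'a::complex_inner)"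
  by (metis cinner_scaleC_left cinner_commute complex_cnj_mult)

lemma cinner_minus_left: "cinner (- x) y = - cinner x (y::'a::complex_inner)"
  by (metis add.right_inverse add_cancel_right_left cinner_add_left eq_neg_iff_add_eq_0 add.commute)

lemma cinner_diff_left: "cinner (x - y) z = cinner x z - cinner y (z::'a::complex_inner)"
  by (metis cinner_add_left cinner_minus_left uminus_add_conv_diff add.commute)

lemma cinner_diff_right: "cinner z (x - y) = cinner z x - cinner z (y::'a::complex_inner)"
  by (metis cinner_diff_left cinner_commute complex_cnj_diff)

lemma cinner_self: "cinner x x = complex_of_real ((norm (x::'a::complex_inner))\<^sup>2)"
proof -
  have "Im (cinner x x) = 0"
    by (metis cinner_commute cnj.sel(2) equal_neg_zero)
  moreover have "Re (cinner x x) = (norm x)\<^sup>2"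
    by (simp add: inner_Re[symmetric] power2_norm_eq_inner)
  ultimately show ?thesis
    by (simp add: complex_eq_iff)
qed

lemma norm_scaleC: "norm (c *\<^sub>C x) = cmod c * norm (x::'a::complex_inner)"
proof -
  have "complex_of_real ((norm (c *\<^sub>C x))\<^sup>2) = complex_of_real ((cmod c * norm x)\<^sup>2)"
    by (simp only: cinner_self[symmetric] cinner_scaleC_left cinner_scaleC_right)
       (simp add: cinner_self complex_norm_square[unfolded of_real_power] power_mult_distrib mult_ac)
  then have "(norm (c *\<^sub>C x))\<^sup>2 = (cmod c * norm x)\<^sup>2"
    using of_real_eq_iff by blast
  then show ?thesis
    by (simp add: power2_eq_iff_nonneg)
qed

lemma cinner_Cauchy_Schwarz: "cmod (cinner x y) \<le> norm x * norm (y::'a::complex_inner)"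
proof (cases "cinner x y = 0")
  case False
  define c where "c = cnj (sgn (cinner x y))"
  have c: "cmod c = 1"
    using False by (simp add: c_def norm_sgn)
  have "cinner (c *\<^sub>C x) y = complex_of_real (cmod (cinner x y))"
  proof -
    have "c * cinner x y = cinner x y * cnj (cinner x y) / cmod (cinner x y)"
      by (simp add: c_def sgn_eq)
    also have "\<dots> = complex_of_real (cmod (cinner x y))"
      using False by (simp add: complex_norm_square[symmetric] power2_eq_square)
    finally show ?thesis
      by (simp add: cinner_scaleC_left)
  qed
  then have "cmod (cinner x y) = inner (c *\<^sub>C x) y"
    by (simp add: inner_Re)
  also have "\<dots> \<le> norm (c *\<^sub>C x) * norm y"
    by (rule norm_cauchy_schwarz)
  finally show ?thesis
    by (simp add: norm_scaleC c)
qed simp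

instantiation complex :: complex_hilbert
begin
definition "scaleC_complex = ((*) :: complex \<Rightarrow> complex \<Rightarrow> complex)"
definition "cinner_complex x y = x * cnj (y::complex)"
instance
  by standard
    (simp_all add: scaleC_complex_def cinner_complex_def algebra_simps scaleR_conv_of_real
      inner_complex_def)
end

definition bounded_clinear :: "('a::complex_inner \<Rightarrow> 'b::complex_inner) \<Rightarrow> bool"
  where "bounded_clinear T \<longleftrightarrow> bounded_linear T \<and> (\<forall>c x. T (c *\<^sub>C x) = c *\<^sub>C T x)"

definition cadjoint :: "('a::complex_inner \<Rightarrow> 'b::complex_inner) \<Rightarrow> 'b \<Rightarrow> 'a"
  where "cadjoint T = (THE T'. \<forall>x y. cinner (T x) y = cinner x (T' y))"

lemma cinner_ext:
  assumes "\<And>z. cinner z x = cinner z (y::'a::complex_inner)"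
  shows "x = y"
proof -
  have "cinner (x - y) (x - y) = 0"
    by (simp add: cinner_diff_right assms)
  then show ?thesis
    by (simp add: cinner_self)
qed

lemma cadjoint_eqI:
  fixes T :: "'a::complex_inner \<Rightarrow> 'b::complex_inner"
  assumes "\<And>x y. cinner (T x) y = cinner x (T' y)"
  shows "cadjoint T = T'"
proof -
  have 1: "\<forall>x y. cinner (T x) y = cinner x (T' y)"
    using assms by simp
  have 2: "T'' = T'" if "\<forall>x y. cinner (T x) y = cinner x (T'' y)" for T''
  proof
    fix y
    show "T'' y = T' y"
    proof (rule cinner_ext)
      fix x
      have "cinner x (T'' y) = cinner (T x) y"
        using that by simp
      also have "\<dots> = cinner x (T' y)"
        by (rule assms)
      finally show "cinner x (T'' y) = cinner x (T' y)" .
    qed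
  qed
  show ?thesis
    unfolding cadjoint_def using 1 2 by (rule the_equality)
qed

definition unitary_between ::
    "'a::complex_inner set \<Rightarrow> 'b::complex_inner set \<Rightarrow> ('a \<Rightarrow> 'b) \<Rightarrow> bool"
  where "unitary_between V W U \<longleftrightarrow>
    csubspace V \<and> closed V \<and> csubspace W \<and> closed W \<and>
    (\<forall>x\<in>V. \<forall>y\<in>V. U (x + y) = U x + U y) \<and> (\<forall>c. \<forall>x\<in>V. U (c *\<^sub>C x) = c *\<^sub>C U x) \<and>
    U ` V = W \<and> (\<forall>x\<in>V. \<forall>y\<in>V. cinner (U x) (U y) = cinner x y)"

abbreviation unitary_on :: "'a::complex_inner set \<Rightarrow> ('a \<Rightarrow> 'a) \<Rightarrow> bool"
  where "unitary_on V T \<equiv> unitary_between V V T"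

definition projection_on :: "'a::complex_inner set \<Rightarrow> ('a \<Rightarrow> 'a) \<Rightarrow> bool"
  where "projection_on V T \<longleftrightarrow>
    csubspace V \<and> closed V \<and>
    (\<forall>x\<in>V. \<forall>y\<in>V. T (x + y) = T x + T y) \<and> (\<forall>c. \<forall>x\<in>V. T (c *\<^sub>C x) = c *\<^sub>C T x) \<and>
    T ` V \<subseteq> V \<and> (\<forall>x\<in>V. T (T x) = T x) \<and> (\<forall>x\<in>V. \<forall>y\<in>V. cinner (T x) y = cinner x (T y))"

text \<open>Under \<open>U\<close>, defined on the subspace \<open>V\<close>, the restriction of \<open>T\<close> to \<open>V\<close> becomes \<open>C\<close>.\<close>

definition restriction_equiv ::
    "('a \<Rightarrow> 'b) \<Rightarrow> 'a set \<Rightarrow> ('a \<Rightarrow> 'a) \<Rightarrow> ('b \<Rightarrow> 'b) \<Rightarrow> bool"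
  where "restriction_equiv U V T C \<longleftrightarrow> T ` V \<subseteq> V \<and> (\<forall>x\<in>V. U (T x) = C (U x))"


section \<open>Square-summable sequences and the tensor product with \<open>\<ell>\<^sup>2\<close>\<close>

typedef (overloaded) 'h l2 = "{f :: nat \<Rightarrow> 'h::complex_inner. summable (\<lambda>l. (norm (f l))\<^sup>2)}"
  morphisms l2_nth Abs_l2
  by (rule exI[of _ "\<lambda>_. 0"]) simp

setup_lifting type_definition_l2

lemma summable_l2_nth: "summable (\<lambda>l. (norm (l2_nth f l))\<^sup>2)"
  using l2_nth by blast

lemma l2_eqI: "(\<And>l. l2_nth f l = l2_nth g l) \<Longrightarrow> f = g"
  by (metis ext l2_nth_inject)

lemma sum_square_bound: "(a + b)\<^sup>2 \<le> 2 * a\<^sup>2 + 2 * (b::real)\<^sup>2"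
  using sum_squares_bound[of a b] by (simp add: power2_sum)

lemma summable_norm_cinner: "summable (\<lambda>l. cmod (cinner (l2_nth f l) (l2_nth g l)))"
proof (rule summable_comparison_test')
  show "summable (\<lambda>l. (norm (l2_nth f l))\<^sup>2 + (norm (l2_nth g l))\<^sup>2)"
    by (intro summable_add summable_l2_nth)
  fix l :: nat
  let ?a = "norm (l2_nth f l)" and ?b = "norm (l2_nth g l)"
  have "cmod (cinner (l2_nth f l) (l2_nth g l)) \<le> ?a * ?b"
    by (rule cinner_Cauchy_Schwarz)
  moreover have "2 * (?a * ?b) \<le> ?a\<^sup>2 + ?b\<^sup>2"
    using sum_squares_bound[of ?a ?b] by simp
  moreover have "0 \<le> ?a * ?b" by simp
  ultimately have "cmod (cinner (l2_nth f l) (l2_nth g l)) \<le> ?a\<^sup>2 + ?b\<^sup>2"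
    by linarith
  then show "norm (cmod (cinner (l2_nth f l) (l2_nth g l))) \<le> ?a\<^sup>2 + ?b\<^sup>2"
    by simp
qed

lemma summable_cinner: "summable (\<lambda>l. cinner (l2_nth f l) (l2_nth g l))"
  using summable_norm_cinner by (rule summable_norm_cancel)

instantiation l2 :: (complex_inner) real_vector
begin

lift_definition zero_l2 :: "'a l2" is "\<lambda>_. 0" by simp
lift_definition plus_l2 :: "'a l2 \<Rightarrow> 'a l2 \<Rightarrow> 'a l2" is "\<lambda>f g l. f l + g l"
proof -
  fix f g :: "nat \<Rightarrow> 'a"
  assume s: "summable (\<lambda>l. (norm (f l))\<^sup>2)" "summable (\<lambda>l. (norm (g l))\<^sup>2)"
  show "summable (\<lambda>l. (norm (f l + g l))\<^sup>2)"
  proof (rule summable_comparison_test')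
    show "summable (\<lambda>l. 2 * (norm (f l))\<^sup>2 + 2 * (norm (g l))\<^sup>2)"
      using s by (intro summable_add summable_mult)
    fix l :: nat
    have "(norm (f l + g l))\<^sup>2 \<le> (norm (f l) + norm (g l))\<^sup>2"
      by (simp add: norm_triangle_ineq power_mono)
    also have "\<dots> \<le> 2 * (norm (f l))\<^sup>2 + 2 * (norm (g l))\<^sup>2"
      by (rule sum_square_bound)
    finally show "norm ((norm (f l + g l))\<^sup>2) \<le> 2 * (norm (f l))\<^sup>2 + 2 * (norm (g l))\<^sup>2"
      by simp
  qed
qed
lift_definition uminus_l2 :: "'a l2 \<Rightarrow> 'a l2" is "\<lambda>f l. - f l" by simp
definition minus_l2 :: "'a l2 \<Rightarrow> 'a l2 \<Rightarrow> 'a l2" where "minus_l2 f g = f + - g"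
lift_definition scaleR_l2 :: "real \<Rightarrow> 'a l2 \<Rightarrow> 'a l2" is "\<lambda>r f l. r *\<^sub>R f l"
  by (simp add: power_mult_distrib summable_mult)

instance
  by standard
    (auto intro!: l2_eqI simp: zero_l2.rep_eq plus_l2.rep_eq uminus_l2.rep_eq minus_l2_def
      scaleR_l2.rep_eq scaleR_add_right scaleR_add_left)

end

instantiation l2 :: (complex_inner) complex_inner
begin

lift_definition scaleC_l2 :: "complex \<Rightarrow> 'a l2 \<Rightarrow> 'a l2" is "\<lambda>c f l. c *\<^sub>C f l"
  by (simp add: norm_scaleC power_mult_distrib summable_mult)
definition cinner_l2 :: "'a l2 \<Rightarrow> 'a l2 \<Rightarrow> complex"
  where "cinner_l2 f g = (\<Sum>l. cinner (l2_nth f l) (l2_nth g l))"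
definition inner_l2 :: "'a l2 \<Rightarrow> 'a l2 \<Rightarrow> real" where "inner_l2 f g = Re (cinner f g)"
definition norm_l2 :: "'a l2 \<Rightarrow> real" where "norm_l2 f = sqrt (inner f f)"
definition sgn_l2 :: "'a l2 \<Rightarrow> 'a l2" where "sgn_l2 f = f /\<^sub>R norm f"
definition dist_l2 :: "'a l2 \<Rightarrow> 'a l2 \<Rightarrow> real" where "dist_l2 f g = norm (f - g)"
definition uniformity_l2 :: "('a l2 \<times> 'a l2) filter"
  where "uniformity_l2 = (INF e\<in>{0<..}. principal {(f, g). dist f g < e})"
definition open_l2 :: "'a l2 set \<Rightarrow> bool"
  where "open_l2 X = (\<forall>f\<in>X. eventually (\<lambda>(f', g). f' = f \<longrightarrow> g \<in> X) uniformity)"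

instance
proof
  fix f g h :: "'a l2" and c d :: complex and r :: real
  note nth = zero_l2.rep_eq plus_l2.rep_eq uminus_l2.rep_eq minus_l2_def scaleC_l2.rep_eq scaleR_l2.rep_eq
  show "c *\<^sub>C (f + g) = c *\<^sub>C f + c *\<^sub>C g" "(c + d) *\<^sub>C f = c *\<^sub>C f + d *\<^sub>C f"
    "c *\<^sub>C d *\<^sub>C f = (c * d) *\<^sub>C f" and real: "r *\<^sub>R f = complex_of_real r *\<^sub>C f"
    by (auto intro!: l2_eqI simp: nth scaleC_add_right scaleC_add_left scaleC_scaleC scaleR_scaleC)
  show comm: "cinner f g = cnj (cinner g f)" for f g :: "'a l2"
  proof -
    have "(\<Sum>l. cnj (cinner (l2_nth g l) (l2_nth f l))) = cnj (\<Sum>l. cinner (l2_nth g l) (l2_nth f l))"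
      using sums_cnj[THEN iffD2, OF summable_sums[OF summable_cinner[of g f]]] sums_unique by metis
    then show ?thesis
      by (simp add: cinner_l2_def cinner_commute[symmetric])
  qed
  show add: "cinner (f + g) h = cinner f h + cinner g h" for f g h :: "'a l2"
    by (simp add: cinner_l2_def nth cinner_add_left suminf_add summable_cinner)
  show scale: "cinner (c *\<^sub>C f) g = c * cinner f g" for c and f g :: "'a l2"
    by (simp add: cinner_l2_def nth cinner_scaleC_left suminf_mult summable_cinner)
  show "inner f g = Re (cinner f g)"
    by (simp add: inner_l2_def)
  show "inner f g = inner g f"
    by (metis inner_l2_def comm cnj.sel(1))
  show "inner (f + g) h = inner f h + inner g h" "inner (r *\<^sub>R f) g = r * inner f g"
    by (simp_all add: inner_l2_def add real scale)
  have self: "cinner f f = complex_of_real (\<Sum>l. (norm (l2_nth f l))\<^sup>2)"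
    by (simp add: cinner_l2_def cinner_self suminf_of_real[OF summable_l2_nth, symmetric]
        del: of_real_power)
  show "0 \<le> inner f f"
    by (simp add: inner_l2_def self suminf_nonneg summable_l2_nth)
  show "inner f f = 0 \<longleftrightarrow> f = 0"
    using suminf_eq_zero_iff[OF summable_l2_nth[of f]]
    by (auto simp: inner_l2_def self nth intro!: l2_eqI)
  show "norm f = sqrt (inner f f)" "sgn f = f /\<^sub>R norm f" "dist f g = norm (f - g)"
    by (rule norm_l2_def sgn_l2_def dist_l2_def)+
  show "(uniformity :: ('a l2 \<times> 'a l2) filter) = (INF e\<in>{0<..}. principal {(f, g). dist f g < e})"
    by (rule uniformity_l2_def)
  show "open X \<longleftrightarrow> (\<forall>f\<in>X. eventually (\<lambda>(f', g). f' = f \<longrightarrow> g \<in> X) uniformity)" for X :: "'a l2 set"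
    by (rule open_l2_def)
qed

end

lemma l2_nth_diff: "l2_nth (f - g) l = l2_nth f l - l2_nth g l"
  unfolding minus_l2_def plus_l2.rep_eq uminus_l2.rep_eq by simp

lemma norm_l2_square: "(norm f)\<^sup>2 = (\<Sum>l. (norm (l2_nth f l))\<^sup>2)"
proof -
  have "complex_of_real ((norm f)\<^sup>2) = complex_of_real (\<Sum>l. (norm (l2_nth f l))\<^sup>2)"
    unfolding cinner_self[symmetric]
    by (simp add: cinner_l2_def cinner_self suminf_of_real[OF summable_l2_nth, symmetric]
        del: of_real_power)
  then show ?thesis
    using of_real_eq_iff by blast
qed

lemma norm_l2_nth_le: "norm (l2_nth f l) \<le> norm f"
proof -
  have "(norm (l2_nth f l))\<^sup>2 = (\<Sum>i\<in>{l}. (norm (l2_nth f i))\<^sup>2)"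
    by simp
  also have "\<dots> \<le> (norm f)\<^sup>2"
    unfolding norm_l2_square by (rule sum_le_suminf) (simp_all add: summable_l2_nth)
  finally show ?thesis
    by (simp add: power2_le_iff_abs_le)
qed

instance l2 :: (complex_hilbert) complex_hilbert
proof
  fix X :: "nat \<Rightarrow> 'a l2"
  assume X: "Cauchy X"
  have "Cauchy (\<lambda>n. l2_nth (X n) l)" for l
  proof (rule metric_CauchyI)
    fix e :: real assume "e > 0"
    then obtain M where M: "\<forall>m\<ge>M. \<forall>n\<ge>M. dist (X m) (X n) < e"
      using X metric_CauchyD by blast
    have "dist (l2_nth (X m) l) (l2_nth (X n) l) \<le> dist (X m) (X n)" for m n
      using norm_l2_nth_le[of "X m - X n" l] by (simp add: dist_norm l2_nth_diff)
    then show "\<exists>M. \<forall>m\<ge>M. \<forall>n\<ge>M. dist (l2_nth (X m) l) (l2_nth (X n) l) < e"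
      using M by (meson le_less_trans)
  qed
  then have "\<forall>l. \<exists>a. (\<lambda>n. l2_nth (X n) l) \<longlonglongrightarrow> a"
    by (auto simp: Cauchy_convergent_iff convergent_def)
  then obtain g where g: "\<And>l. (\<lambda>n. l2_nth (X n) l) \<longlonglongrightarrow> g l"
    by metis
  have partial: "(\<Sum>l<N. (norm (l2_nth (X m) l - g l))\<^sup>2) \<le> e\<^sup>2"
    if "\<forall>n\<ge>M. dist (X m) (X n) < e" for N M m and e :: real
  proof (rule LIMSEQ_le_const2)
    show "(\<lambda>n. \<Sum>l<N. (norm (l2_nth (X m) l - l2_nth (X n) l))\<^sup>2)
        \<longlonglongrightarrow> (\<Sum>l<N. (norm (l2_nth (X m) l - g l))\<^sup>2)"
      by (intro tendsto_intros g)
    have "(\<Sum>l<N. (norm (l2_nth (X m) l - l2_nth (X n) l))\<^sup>2) \<le> e\<^sup>2" if "n \<ge> M" for n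
    proof -
      have "(\<Sum>l<N. (norm (l2_nth (X m) l - l2_nth (X n) l))\<^sup>2) \<le> (norm (X m - X n))\<^sup>2"
        unfolding norm_l2_square l2_nth_diff[symmetric]
        by (rule sum_le_suminf) (simp_all add: summable_l2_nth)
      also have "\<dots> \<le> e\<^sup>2"
        using \<open>\<forall>n\<ge>M. dist (X m) (X n) < e\<close> that by (simp add: dist_norm power_mono less_imp_le)
      finally show ?thesis .
    qed
    then show "\<exists>M. \<forall>n\<ge>M. (\<Sum>l<N. (norm (l2_nth (X m) l - l2_nth (X n) l))\<^sup>2) \<le> e\<^sup>2"
      by blast
  qed
  have diff: "summable (\<lambda>l. (norm (l2_nth (X m) l - g l))\<^sup>2)"
    "(\<Sum>l. (norm (l2_nth (X m) l - g l))\<^sup>2) \<le> e\<^sup>2"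
    if "\<forall>n\<ge>M. dist (X m) (X n) < e" for M m and e :: real
  proof -
    show s: "summable (\<lambda>l. (norm (l2_nth (X m) l - g l))\<^sup>2)"
      using partial[OF that] by (intro summableI_nonneg_bounded) auto
    show "(\<Sum>l. (norm (l2_nth (X m) l - g l))\<^sup>2) \<le> e\<^sup>2"
      using partial[OF that] s by (intro suminf_le_const) auto
  qed
  obtain M1 where M1: "\<forall>m\<ge>M1. \<forall>n\<ge>M1. dist (X m) (X n) < 1"
    using X metric_CauchyD zero_less_one by blast
  define d where "d = Abs_l2 (\<lambda>l. l2_nth (X M1) l - g l)"
  have d: "l2_nth d l = l2_nth (X M1) l - g l" for l
    unfolding d_def using diff(1)[of M1 M1 1] M1 by (subst Abs_l2_inverse) auto
  define G where "G = X M1 - d"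
  have G: "l2_nth G l = g l" for l
    by (simp add: G_def l2_nth_diff d)
  have "X \<longlonglongrightarrow> G"
  proof (rule metric_LIMSEQ_I)
    fix e :: real assume e: "e > 0"
    then obtain M where M: "\<forall>m\<ge>M. \<forall>n\<ge>M. dist (X m) (X n) < e / 2"
      using X metric_CauchyD half_gt_zero by blast
    have "dist (X m) G < e" if "m \<ge> M" for m
    proof -
      have "(norm (X m - G))\<^sup>2 \<le> (e / 2)\<^sup>2"
        using diff(2)[of M m "e/2"] M that by (simp add: norm_l2_square l2_nth_diff G)
      then have "norm (X m - G) \<le> e / 2"
        using e by (simp add: power2_le_iff_abs_le)
      then show ?thesis
        using e by (simp add: dist_norm)
    qed
    then show "\<exists>M. \<forall>m\<ge>M. dist (X m) G < e"
      by blast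
  qed
  then show "convergent X"
    by (auto simp: convergent_def)
qed

lift_definition l2_basis :: "nat \<Rightarrow> complex l2" is "\<lambda>k l. if l = k then 1 else 0"
  by (rule summable_finite[of "{_}"]) auto

text \<open>
  The Hilbert space tensor product of \<open>\<ell>\<^sup>2\<close> and \<open>'h\<close> is realised as the space
  \<^typ>\<open>'h l2\<close> of square-summable \<open>'h\<close>-valued sequences, with the elementary tensors below; the
  lemmas \<open>cinner_tens\<close> and \<open>closure_span_tens\<close> show that this is a tensor product.
\<close>

lift_definition tens :: "complex l2 \<Rightarrow> 'h \<Rightarrow> 'h::complex_inner l2" (infixr "\<otimes>\<^sub>e" 74)
  is "\<lambda>x h l. x l *\<^sub>C h"
  by (simp add: norm_scaleC power_mult_distrib summable_mult2)

definition l2_tensor :: "'h::complex_inner set \<Rightarrow> 'h l2 set"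
  where "l2_tensor V = closure (cspan {x \<otimes>\<^sub>e h |x h. h \<in> V})"

definition tensor_op ::
    "(complex l2 \<Rightarrow> complex l2) \<Rightarrow> ('h \<Rightarrow> 'h) \<Rightarrow> 'h::complex_inner l2 \<Rightarrow> 'h l2" (infixr "\<otimes>\<^sub>o\<^sub>p" 74)
  where "A \<otimes>\<^sub>o\<^sub>p T = (THE C. bounded_clinear C \<and> (\<forall>x h. C (x \<otimes>\<^sub>e h) = A x \<otimes>\<^sub>e T h))"

lemma cinner_tens: "cinner (x \<otimes>\<^sub>e h) (y \<otimes>\<^sub>e k) = cinner x y * cinner h k"
proof -
  have "cinner (x \<otimes>\<^sub>e h) (y \<otimes>\<^sub>e k) = (\<Sum>l. cinner (l2_nth x l) (l2_nth y l) * cinner h k)"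
    by (simp add: cinner_l2_def tens.rep_eq cinner_scaleC_left cinner_scaleC_right
        cinner_complex_def mult_ac)
  also have "\<dots> = cinner x y * cinner h k"
    by (simp add: cinner_l2_def suminf_mult2[OF summable_cinner, symmetric])
  finally show ?thesis .
qed

lemma l2_nth_sum: "l2_nth (sum F I) l = (\<Sum>i\<in>I. l2_nth (F i) l)"
  by (induction I rule: infinite_finite_induct) (simp_all add: zero_l2.rep_eq plus_l2.rep_eq)

lemma l2_truncation_tendsto:
  fixes f :: "'h::complex_inner l2"
  shows "(\<lambda>N. \<Sum>l<N. l2_basis l \<otimes>\<^sub>e l2_nth f l) \<longlonglongrightarrow> f"
proof -
  let ?F = "\<lambda>N. \<Sum>l<N. l2_basis l \<otimes>\<^sub>e l2_nth f l"
  let ?a = "\<lambda>l. (norm (l2_nth f l))\<^sup>2"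
  have nth: "l2_nth (f - ?F N) l = (if l < N then 0 else l2_nth f l)" for N l
  proof -
    have "l2_nth (?F N) l = (\<Sum>i<N. if i = l then l2_nth f l else 0)"
      unfolding l2_nth_sum
      by (intro sum.cong) (auto simp: tens.rep_eq l2_basis.rep_eq scaleC_one)
    also have "\<dots> = (if l < N then l2_nth f l else 0)"
      by (simp add: sum.delta)
    finally show ?thesis
      by (simp add: l2_nth_diff)
  qed
  have "(norm (f - ?F N))\<^sup>2 = suminf ?a - sum ?a {..<N}" for N
  proof -
    have eq: "(norm (l2_nth (f - ?F N) l))\<^sup>2 = ?a l - (if l \<in> {..<N} then ?a l else 0)" for l
      by (simp add: nth)
    have "(\<lambda>l. (norm (l2_nth (f - ?F N) l))\<^sup>2) sums (suminf ?a - sum ?a {..<N})"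
      unfolding eq by (intro sums_diff summable_sums summable_l2_nth sums_If_finite_set) simp
    then show ?thesis
      by (simp add: norm_l2_square sums_iff)
  qed
  moreover have "(\<lambda>N. suminf ?a - sum ?a {..<N}) \<longlonglongrightarrow> suminf ?a - suminf ?a"
    by (intro tendsto_intros summable_LIMSEQ summable_l2_nth)
  ultimately have "(\<lambda>N. (norm (f - ?F N))\<^sup>2) \<longlonglongrightarrow> 0"
    by simp
  then have "(\<lambda>N. sqrt ((norm (f - ?F N))\<^sup>2)) \<longlonglongrightarrow> sqrt 0"
    by (rule tendsto_real_sqrt)
  then have "(\<lambda>N. norm (?F N - f)) \<longlonglongrightarrow> 0"
    by (simp add: norm_minus_commute)
  then show ?thesis
    using Lim_null tendsto_norm_zero_iff by blast
qed

lemma closure_span_tens: "l2_tensor (UNIV :: 'h::complex_inner set) = UNIV"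
proof -
  have "f \<in> l2_tensor UNIV" for f :: "'h l2"
    unfolding l2_tensor_def closure_sequential
    by (intro exI[of _ "\<lambda>N. \<Sum>l<N. l2_basis l \<otimes>\<^sub>e l2_nth f l"] conjI allI l2_truncation_tendsto
        complex_vector.span_sum complex_vector.span_base) auto
  then show ?thesis by blast
qed

lemma tensor_op_eqI:
  fixes T :: "'h \<Rightarrow> 'h::complex_inner"
  assumes C: "bounded_clinear C" "\<And>x h. C (x \<otimes>\<^sub>e h) = A x \<otimes>\<^sub>e T h"
  shows "A \<otimes>\<^sub>o\<^sub>p T = C"
  unfolding tensor_op_def
proof (rule the_equality)
  show "bounded_clinear C \<and> (\<forall>x h. C (x \<otimes>\<^sub>e h) = A x \<otimes>\<^sub>e T h)"
    using C by simp
next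
  fix D assume D: "bounded_clinear D \<and> (\<forall>x h. D (x \<otimes>\<^sub>e h) = A x \<otimes>\<^sub>e T h)"
  show "D = C"
  proof
    fix f :: "'h l2"
    let ?F = "\<lambda>N. \<Sum>l<N. l2_basis l \<otimes>\<^sub>e l2_nth f l"
    have lin: "bounded_linear C" "bounded_linear D"
      using C D by (auto simp: bounded_clinear_def)
    have "D (?F N) = C (?F N)" for N
      using C(2) D by (simp add: linear_sum[OF bounded_linear.linear[OF lin(1)]]
          linear_sum[OF bounded_linear.linear[OF lin(2)]])
    then have "(\<lambda>N. C (?F N)) \<longlonglongrightarrow> D f"
      using bounded_linear.tendsto[OF lin(2) l2_truncation_tendsto[of f]] by simp
    then show "D f = C f"
      using bounded_linear.tendsto[OF lin(1) l2_truncation_tendsto[of f]] LIMSEQ_unique by blast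
  qed
qed

lift_definition l2_shift :: "complex l2 \<Rightarrow> complex l2" is "\<lambda>x l. x (Suc l)"
  by (subst summable_Suc_iff)

text \<open>
  The operator \<open>\<lambda>\<^sup>N\<close>, \<open>e\<^sub>l \<mapsto> \<lambda>\<^sup>l e\<^sub>l\<close>. It is bounded only for \<open>cmod c \<le> 1\<close>; outside that
  range \<open>power_N c\<close> is set to \<open>0\<close>.
\<close>

lift_definition power_N :: "complex \<Rightarrow> complex l2 \<Rightarrow> complex l2"
  is "\<lambda>c x l. if cmod c \<le> 1 then c ^ l * x l else 0"
proof -
  fix c :: complex and x :: "nat \<Rightarrow> complex"
  assume s: "summable (\<lambda>l. (norm (x l))\<^sup>2)"
  show "summable (\<lambda>l. (norm (if cmod c \<le> 1 then c ^ l * x l else 0))\<^sup>2)"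
  proof (rule summable_comparison_test'[OF s])
    fix l :: nat
    have "norm (if cmod c \<le> 1 then c ^ l * x l else 0) \<le> norm (x l)"
    proof (cases "cmod c \<le> 1")
      case True
      then have "cmod c ^ l * cmod (x l) \<le> 1 * cmod (x l)"
        by (intro mult_right_mono power_le_one) simp_all
      then show ?thesis
        using True by (simp add: norm_mult norm_power)
    qed simp
    then have "(norm (if cmod c \<le> 1 then c ^ l * x l else 0))\<^sup>2 \<le> (norm (x l))\<^sup>2"
      by (rule power_mono) simp
    then show "norm ((norm (if cmod c \<le> 1 then c ^ l * x l else 0))\<^sup>2) \<le> (norm (x l))\<^sup>2"
      by (simp only: real_norm_def abs_power2)
  qed
qed

lemma l2_shift_basis: "l2_shift (l2_basis 0) = 0" "l2_shift (l2_basis (Suc l)) = l2_basis l"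
  by (auto intro!: l2_eqI simp: l2_shift.rep_eq l2_basis.rep_eq zero_l2.rep_eq)

lemma power_N_basis: "cmod c \<le> 1 \<Longrightarrow> power_N c (l2_basis l) = (c ^ l) *\<^sub>C l2_basis l"
  by (auto intro!: l2_eqI simp: power_N.rep_eq l2_basis.rep_eq scaleC_l2.rep_eq scaleC_complex_def)

definition compose_list :: "('a \<Rightarrow> 'a) list \<Rightarrow> 'a \<Rightarrow> 'a"
  where "compose_list Ts = foldr (\<circ>) Ts id"


section \<open>Unital C*-algebras\<close>

record 'a cstar_algebra = "(complex, 'a) module" +
  adj :: "'a \<Rightarrow> 'a"
  nrm :: "'a \<Rightarrow> real"

definition complex_ring :: "complex ring"
  where "complex_ring = \<lparr>carrier = UNIV, monoid.mult = (*), one = 1, zero = 0, add = (+)\<rparr>"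

locale unital_cstar_algebra = ring A + Module.module complex_ring A
  for A :: "'a cstar_algebra" (structure) +
  assumes smult_mult_left:
      "\<lbrakk>x \<in> carrier A; y \<in> carrier A\<rbrakk> \<Longrightarrow> (c \<odot>\<^bsub>A\<^esub> x) \<otimes>\<^bsub>A\<^esub> y = c \<odot>\<^bsub>A\<^esub> (x \<otimes>\<^bsub>A\<^esub> y)"
    and smult_mult_right:
      "\<lbrakk>x \<in> carrier A; y \<in> carrier A\<rbrakk> \<Longrightarrow> x \<otimes>\<^bsub>A\<^esub> (c \<odot>\<^bsub>A\<^esub> y) = c \<odot>\<^bsub>A\<^esub> (x \<otimes>\<^bsub>A\<^esub> y)"
    and adj_closed: "x \<in> carrier A \<Longrightarrow> adj A x \<in> carrier A"
    and adj_adj: "x \<in> carrier A \<Longrightarrow> adj A (adj A x) = x"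
    and adj_add: "\<lbrakk>x \<in> carrier A; y \<in> carrier A\<rbrakk> \<Longrightarrow> adj A (x \<oplus>\<^bsub>A\<^esub> y) = adj A x \<oplus>\<^bsub>A\<^esub> adj A y"
    and adj_smult: "x \<in> carrier A \<Longrightarrow> adj A (c \<odot>\<^bsub>A\<^esub> x) = cnj c \<odot>\<^bsub>A\<^esub> adj A x"
    and adj_mult: "\<lbrakk>x \<in> carrier A; y \<in> carrier A\<rbrakk> \<Longrightarrow> adj A (x \<otimes>\<^bsub>A\<^esub> y) = adj A y \<otimes>\<^bsub>A\<^esub> adj A x"
    and nrm_eq_zero_iff: "x \<in> carrier A \<Longrightarrow> nrm A x = 0 \<longleftrightarrow> x = \<zero>\<^bsub>A\<^esub>"
    and nrm_triangle: "\<lbrakk>x \<in> carrier A; y \<in> carrier A\<rbrakk> \<Longrightarrow> nrm A (x \<oplus>\<^bsub>A\<^esub> y) \<le> nrm A x + nrm A y"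
    and nrm_smult: "x \<in> carrier A \<Longrightarrow> nrm A (c \<odot>\<^bsub>A\<^esub> x) = cmod c * nrm A x"
    and nrm_mult: "\<lbrakk>x \<in> carrier A; y \<in> carrier A\<rbrakk> \<Longrightarrow> nrm A (x \<otimes>\<^bsub>A\<^esub> y) \<le> nrm A x * nrm A y"
    and cstar_identity: "x \<in> carrier A \<Longrightarrow> nrm A (adj A x \<otimes>\<^bsub>A\<^esub> x) = (nrm A x)\<^sup>2"
    and nrm_complete:
      "\<lbrakk>range X \<subseteq> carrier A; \<forall>e>0. \<exists>M. \<forall>j\<ge>M. \<forall>k\<ge>M. nrm A (X j \<ominus>\<^bsub>A\<^esub> X k) < e\<rbrakk>
        \<Longrightarrow> \<exists>x\<in>carrier A. (\<lambda>k. nrm A (X k \<ominus>\<^bsub>A\<^esub> x)) \<longlonglongrightarrow> 0"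

definition unital_star_hom :: "'a cstar_algebra \<Rightarrow> 'b cstar_algebra \<Rightarrow> ('a \<Rightarrow> 'b) \<Rightarrow> bool"
  where "unital_star_hom A B \<phi> \<longleftrightarrow>
    \<phi> ` carrier A \<subseteq> carrier B \<and> \<phi> \<one>\<^bsub>A\<^esub> = \<one>\<^bsub>B\<^esub> \<and>
    (\<forall>x\<in>carrier A. \<forall>y\<in>carrier A.
      \<phi> (x \<oplus>\<^bsub>A\<^esub> y) = \<phi> x \<oplus>\<^bsub>B\<^esub> \<phi> y \<and> \<phi> (x \<otimes>\<^bsub>A\<^esub> y) = \<phi> x \<otimes>\<^bsub>B\<^esub> \<phi> y) \<and>
    (\<forall>c. \<forall>x\<in>carrier A. \<phi> (c \<odot>\<^bsub>A\<^esub> x) = c \<odot>\<^bsub>B\<^esub> \<phi> x) \<and>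
    (\<forall>x\<in>carrier A. \<phi> (adj A x) = adj B (\<phi> x))"

text \<open>
  A unital *-homomorphism into the bounded operators; the last clause says that the image of
  \<open>adj A x\<close> is the Hilbert space adjoint of the image of \<open>x\<close>.
\<close>

definition unital_representation :: "'a cstar_algebra \<Rightarrow> ('a \<Rightarrow> 'h \<Rightarrow> 'h::complex_hilbert) \<Rightarrow> bool"
  where "unital_representation A \<pi> \<longleftrightarrow>
    (\<forall>x\<in>carrier A. bounded_clinear (\<pi> x)) \<and> \<pi> \<one>\<^bsub>A\<^esub> = id \<and>
    (\<forall>x\<in>carrier A. \<forall>y\<in>carrier A.
      \<pi> (x \<oplus>\<^bsub>A\<^esub> y) = (\<lambda>h. \<pi> x h + \<pi> y h) \<and> \<pi> (x \<otimes>\<^bsub>A\<^esub> y) = \<pi> x \<circ> \<pi> y) \<and>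
    (\<forall>c. \<forall>x\<in>carrier A. \<pi> (c \<odot>\<^bsub>A\<^esub> x) = (\<lambda>h. c *\<^sub>C \<pi> x h)) \<and>
    (\<forall>x\<in>carrier A. \<forall>h k. cinner (\<pi> x h) k = cinner h (\<pi> (adj A x) k))"

inductive_set star_subalgebra :: "'a cstar_algebra \<Rightarrow> 'a set \<Rightarrow> 'a set"
  for A :: "'a cstar_algebra" and G :: "'a set"
where
  gen: "x \<in> G \<Longrightarrow> x \<in> star_subalgebra A G"
| one: "\<one>\<^bsub>A\<^esub> \<in> star_subalgebra A G"
| add: "\<lbrakk>x \<in> star_subalgebra A G; y \<in> star_subalgebra A G\<rbrakk> \<Longrightarrow> x \<oplus>\<^bsub>A\<^esub> y \<in> star_subalgebra A G"
| mult: "\<lbrakk>x \<in> star_subalgebra A G; y \<in> star_subalgebra A G\<rbrakk> \<Longrightarrow> x \<otimes>\<^bsub>A\<^esub> y \<in> star_subalgebra A G"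
| smult: "x \<in> star_subalgebra A G \<Longrightarrow> c \<odot>\<^bsub>A\<^esub> x \<in> star_subalgebra A G"
| adj: "x \<in> star_subalgebra A G \<Longrightarrow> adj A x \<in> star_subalgebra A G"

definition list_prod :: "'a cstar_algebra \<Rightarrow> 'a list \<Rightarrow> 'a"
  where "list_prod A xs = foldr (\<lambda>x y. x \<otimes>\<^bsub>A\<^esub> y) xs \<one>\<^bsub>A\<^esub>"


section \<open>The algebra \<open>B\<^sub>\<Theta>\<close>\<close>

definition twist :: "(nat \<Rightarrow> nat \<Rightarrow> real) \<Rightarrow> nat \<Rightarrow> nat \<Rightarrow> complex"
  where "twist \<theta> i j = exp (2 * complex_of_real pi * \<i> * complex_of_real (\<theta> i j))"

definition B_relations ::
    "nat \<Rightarrow> nat \<Rightarrow> (nat \<Rightarrow> nat \<Rightarrow> real) \<Rightarrow> 'a cstar_algebra \<Rightarrow> (nat \<Rightarrow> 'a) \<Rightarrow> bool"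
  where "B_relations m n \<theta> A s \<longleftrightarrow>
    (\<forall>i\<in>{1..m+n}. s i \<in> carrier A) \<and>
    (\<forall>i j. 1 \<le> i \<and> i < j \<and> j \<le> m + n \<longrightarrow> s i \<otimes>\<^bsub>A\<^esub> s j = twist \<theta> i j \<odot>\<^bsub>A\<^esub> (s j \<otimes>\<^bsub>A\<^esub> s i)) \<and>
    (\<forall>i\<in>{1..m+n}. adj A (s i) \<otimes>\<^bsub>A\<^esub> s i = \<one>\<^bsub>A\<^esub>) \<and>
    (\<forall>i\<in>{1..m}. s i \<otimes>\<^bsub>A\<^esub> adj A (s i) = \<one>\<^bsub>A\<^esub>)"

text \<open>
  \<open>B\<close> with the generators \<open>s 1, ..., s (m + n)\<close> is the universal unital C*-algebra for the
  relations. In the universal property it suffices to test against finitely generated, hence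
  separable, C*-algebras. Such an algebra has at most continuum many elements, so up to isomorphism
  its carrier is a subset of \<^typ>\<open>real\<close> (used only as a set of labels; the algebraic structure
  on the carrier is arbitrary). Quantifying over \<^typ>\<open>real cstar_algebra\<close> is therefore no
  restriction.
\<close>

definition universal_B ::
    "nat \<Rightarrow> nat \<Rightarrow> (nat \<Rightarrow> nat \<Rightarrow> real) \<Rightarrow> 'a cstar_algebra \<Rightarrow> (nat \<Rightarrow> 'a) \<Rightarrow> bool"
  where "universal_B m n \<theta> B s \<longleftrightarrow>
    unital_cstar_algebra B \<and> B_relations m n \<theta> B s \<and>
    (\<forall>x\<in>carrier B. \<forall>e>0. \<exists>y\<in>star_subalgebra B (s ` {1..m+n}). nrm B (x \<ominus>\<^bsub>B\<^esub> y) < e) \<and>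
    (\<forall>(A :: real cstar_algebra) t. unital_cstar_algebra A \<and> B_relations m n \<theta> A t \<longrightarrow>
      (\<exists>\<phi>. unital_star_hom B A \<phi> \<and> (\<forall>i\<in>{1..m+n}. \<phi> (s i) = t i)))"

text \<open>\<open>omit_prod B s a b i\<close> is the product of \<open>s a, ..., s b\<close> in increasing order, \<open>s i\<close> omitted.\<close>

definition omit_prod :: "'a cstar_algebra \<Rightarrow> (nat \<Rightarrow> 'a) \<Rightarrow> nat \<Rightarrow> nat \<Rightarrow> nat \<Rightarrow> 'a"
  where "omit_prod B s a b i = list_prod B (map s (filter (\<lambda>j. j \<noteq> i) [a..<Suc b]))"

text \<open>
  \<open>Q_isom\<close> is the product of \<open>s (m + 1), ..., s (m + n)\<close> without \<open>s i\<close>, and \<open>Q_all\<close> that of all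
  of \<open>s 1, ..., s (m + n)\<close> without \<open>s i\<close>; they coincide for \<open>m = 0\<close>. The formula for
  \<open>\<pi> (s k)\<close> with \<open>k > m\<close> rests on \<open>s k Q\<^sub>k\<close> being \<open>\<Prod>i<k. cnj (\<lambda>\<^sub>i\<^sub>k)\<close> times
  \<open>s 1 \<cdots> s (m + n)\<close>, which holds for \<open>Q_all\<close> but, if \<open>m > 0\<close>, not for \<open>Q_isom\<close>. With \<open>Q_isom\<close>
  that formula fails: take \<open>m = n = 1\<close>, \<open>\<theta> = 0\<close>, \<open>\<pi> (s 1) = -1\<close>, \<open>\<pi> (s 2)\<close> the unilateral shift.
\<close>

definition Q_isom :: "nat \<Rightarrow> nat \<Rightarrow> 'a cstar_algebra \<Rightarrow> (nat \<Rightarrow> 'a) \<Rightarrow> nat \<Rightarrow> 'a"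
  where "Q_isom m n B s i = omit_prod B s (m + 1) (m + n) i"

definition Q_all :: "nat \<Rightarrow> nat \<Rightarrow> 'a cstar_algebra \<Rightarrow> (nat \<Rightarrow> 'a) \<Rightarrow> nat \<Rightarrow> 'a"
  where "Q_all m n B s i = omit_prod B s 1 (m + n) i"

definition u_elem :: "'a cstar_algebra \<Rightarrow> (nat \<Rightarrow> 'a) \<Rightarrow> (nat \<Rightarrow> 'a) \<Rightarrow> nat \<Rightarrow> 'a"
  where "u_elem B s Q i =
    s i \<otimes>\<^bsub>B\<^esub> (\<one>\<^bsub>B\<^esub> \<ominus>\<^bsub>B\<^esub> Q i \<otimes>\<^bsub>B\<^esub> adj B (Q i)) \<oplus>\<^bsub>B\<^esub>
    (\<one>\<^bsub>B\<^esub> \<ominus>\<^bsub>B\<^esub> s i \<otimes>\<^bsub>B\<^esub> adj B (s i)) \<otimes>\<^bsub>B\<^esub> adj B (Q i)"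

definition P_elem :: "'a cstar_algebra \<Rightarrow> (nat \<Rightarrow> 'a) \<Rightarrow> (nat \<Rightarrow> 'a) \<Rightarrow> nat \<Rightarrow> 'a"
  where "P_elem B s Q i =
    Q i \<otimes>\<^bsub>B\<^esub> (\<one>\<^bsub>B\<^esub> \<ominus>\<^bsub>B\<^esub> s i \<otimes>\<^bsub>B\<^esub> adj B (s i)) \<otimes>\<^bsub>B\<^esub> adj B (Q i)"


section \<open>The Wold decomposition\<close>

definition defect_projection :: "('h \<Rightarrow> 'h) \<Rightarrow> 'h \<Rightarrow> 'h::complex_inner"
  where "defect_projection T = (\<lambda>h. h - T (cadjoint T h))"

definition unitary_part :: "('h \<Rightarrow> 'h) \<Rightarrow> 'h set"
  where "unitary_part T = {h. \<forall>k>0. \<exists>h'. h = (T ^^ k) h'}"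

definition shift_part :: "('h \<Rightarrow> 'h) \<Rightarrow> 'h::complex_inner set"
  where "shift_part T = closure (cspan {(T ^^ k) \<eta> |k \<eta>. \<eta> \<in> range (defect_projection T)})"

text \<open>
  \<open>diag_op \<theta> M k\<close> is the product of the operators \<open>(\<lambda>\<^sub>i\<^sub>k\<^sup>N)\<^sup>*\<close> over \<open>1 \<le> i < k\<close> and of
  \<open>\<lambda>\<^sub>k\<^sub>i\<^sup>N\<close> over \<open>k < i \<le> M\<close>.
\<close>

definition diag_op :: "(nat \<Rightarrow> nat \<Rightarrow> real) \<Rightarrow> nat \<Rightarrow> nat \<Rightarrow> complex l2 \<Rightarrow> complex l2"
  where "diag_op \<theta> M k =
    compose_list (map (\<lambda>i. cadjoint (power_N (twist \<theta> i k))) [1..<k]) \<circ>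
    compose_list (map (\<lambda>i. power_N (twist \<theta> k i)) [k+1..<Suc M])"

end

theory Submission
  imports Defs
begin

text \<open>
  Up to a unimodular factor, \<open>\<alpha> = V W Z\<close> with \<open>V\<close> the image of \<open>s k\<close>, \<open>W\<close> that of \<open>Q\<^sub>k\<close>, and \<open>Z\<close> a
  product of unitary generators. As \<open>V\<close> and \<open>W\<close> commute up to a scalar, the defect space of \<open>\<alpha>\<close> is
  \<open>ker V\<^sup>* \<oplus> V ker W\<^sup>* = ker W\<^sup>* \<oplus> W ker V\<^sup>*\<close>. The operator \<open>u\<close> of Berger, Coburn and Lebow maps the
  second decomposition to the first one, by \<open>V\<close> on \<open>ker W\<^sup>*\<close> and by \<open>W\<^sup>*\<close> on \<open>W ker V\<^sup>*\<close>, and \<open>p\<close> is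
  the projection onto \<open>W ker V\<^sup>*\<close>. Hence \<open>V \<eta> = V W u p \<eta> + u (1 - p) \<eta>\<close> on the defect space, which
  is the last claim because \<open>V\<close> commutes with \<open>\<alpha>\<close> up to a scalar. The identification of \<open>K\<close> sends
  \<open>h\<close> to the sequence \<open>(P \<alpha>\<^sup>*\<^sup>l h)\<^sub>l\<close>, which makes sense on the whole space.
\<close>

section \<open>Bounded operators and adjoints\<close>

lemma bounded_clinear_simps:
  assumes "bounded_clinear T"
  shows "T (x + y) = T x + T y" "T (x - y) = T x - T y" "T (- x) = - T x" "T 0 = 0"
    "T (c *\<^sub>C x) = c *\<^sub>C T x"
  using assms by (auto simp: bounded_clinear_def linear_simps)

lemma bounded_clinearI:
  assumes "\<And>x y. T (x + y) = T x + T y" "\<And>c x. T (c *\<^sub>C x) = c *\<^sub>C T x"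
    and "\<And>x. norm (T x) \<le> norm x * b"
  shows "bounded_clinear T"
  unfolding bounded_clinear_def
  by (intro conjI bounded_linear_intro[of T b] allI) (simp_all add: assms scaleR_scaleC)

lemma bounded_clinear_ident: "bounded_clinear (\<lambda>x. x)"
  by (simp add: bounded_clinear_def)

lemma bounded_clinear_id: "bounded_clinear id"
  using bounded_clinear_ident by (simp add: id_def)

lemma bounded_clinear_compose:
  "bounded_clinear F \<Longrightarrow> bounded_clinear G \<Longrightarrow> bounded_clinear (\<lambda>x. F (G x))"
  by (simp add: bounded_clinear_def bounded_linear_compose)

lemma bounded_clinear_comp:
  "bounded_clinear F \<Longrightarrow> bounded_clinear G \<Longrightarrow> bounded_clinear (F \<circ> G)"
  using bounded_clinear_compose by (simp add: comp_def)

lemma bounded_clinear_add: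
  "bounded_clinear F \<Longrightarrow> bounded_clinear G \<Longrightarrow> bounded_clinear (\<lambda>x. F x + G x)"
  by (simp add: bounded_clinear_def bounded_linear_add scaleC_add_right)

lemma bounded_clinear_sub:
  "bounded_clinear F \<Longrightarrow> bounded_clinear G \<Longrightarrow> bounded_clinear (\<lambda>x. F x - G x)"
  by (simp add: bounded_clinear_def bounded_linear_sub complex_vector.scale_right_diff_distrib)

lemma bounded_clinear_scaleC: "bounded_clinear (\<lambda>x. c *\<^sub>C x)"
  by (rule bounded_clinearI[where b = "cmod c"])
     (simp_all add: scaleC_add_right scaleC_scaleC mult.commute norm_scaleC)

lemma bounded_clinear_funpow:
  "bounded_clinear T \<Longrightarrow> bounded_clinear (T ^^ k)" for T :: "'a::complex_inner \<Rightarrow> 'a"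
  by (induction k) (auto intro: bounded_clinear_comp bounded_clinear_id)

lemma bounded_clinear_continuous: "bounded_clinear T \<Longrightarrow> continuous_on A T"
  by (simp add: bounded_clinear_def linear_continuous_on)

lemma bounded_clinear_tendsto:
  "bounded_clinear T \<Longrightarrow> f \<longlonglongrightarrow> x \<Longrightarrow> (\<lambda>n. T (f n)) \<longlonglongrightarrow> T x"
  by (simp add: bounded_clinear_def bounded_linear.tendsto)

lemma closed_equalizer:
  assumes "continuous_on UNIV F" "continuous_on UNIV (G :: 'a::t2_space \<Rightarrow> 'b::real_normed_vector)"
  shows "closed {x. F x = G x}"
  using closed_Collect_eq assms by blast

lemma cinner_zero: "cinner 0 x = 0" "cinner x 0 = 0"
  using cinner_diff_left[of x x] cinner_diff_right[of _ x x] by simp_all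

lemma bounded_linear_cinner_right: "bounded_linear (\<lambda>x. cinner (y::'a::complex_inner) x)"
  by (rule bounded_linear_intro[where K = "norm y"])
     (simp_all add: cinner_add_right scaleR_scaleC[where 'a = 'a] cinner_scaleC_right
       scaleR_conv_of_real cinner_Cauchy_Schwarz[THEN order_trans] mult.commute)

section \<open>Complex subspaces: closures, preimages, equalizers and images\<close>

lemma csubspace_closure:
  assumes "csubspace (V :: 'a::complex_inner set)"
  shows "csubspace (closure V)"
proof (rule complex_vector.subspaceI)
  show "0 \<in> closure V"
    using complex_vector.subspace_0[OF assms] closure_subset by blast
next
  fix x y assume "x \<in> closure V" "y \<in> closure V"
  then obtain f g where "\<And>n. f n \<in> V" "f \<longlonglongrightarrow> x" "\<And>n. g n \<in> V" "g \<longlonglongrightarrow> y"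
    unfolding closure_sequential by blast
  then show "x + y \<in> closure V"
    unfolding closure_sequential
    by (intro exI[of _ "\<lambda>n. f n + g n"] conjI allI tendsto_add complex_vector.subspace_add[OF assms])
next
  fix c x assume "x \<in> closure V"
  then obtain f where f: "\<And>n. f n \<in> V" "f \<longlonglongrightarrow> x"
    unfolding closure_sequential by blast
  have "(\<lambda>n. c *\<^sub>C f n) \<longlonglongrightarrow> c *\<^sub>C x"
    by (rule bounded_clinear_tendsto[OF bounded_clinear_scaleC f(2)])
  then show "c *\<^sub>C x \<in> closure V"
    unfolding closure_sequential using f(1)
    by (intro exI[of _ "\<lambda>n. c *\<^sub>C f n"] conjI allI complex_vector.subspace_scale[OF assms])
qed

lemma closure_cspan_subset:
  "G \<subseteq> V \<Longrightarrow> csubspace V \<Longrightarrow> closed V \<Longrightarrow> closure (cspan G) \<subseteq> V"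
  by (simp add: closure_minimal complex_vector.span_minimal)

lemma subset_closure_cspan: "G \<subseteq> closure (cspan G)"
  using closure_subset complex_vector.span_superset by (metis order_trans)

lemma csubspace_closure_cspan: "csubspace (closure (cspan (G :: 'a::complex_inner set)))"
  by (simp add: csubspace_closure complex_vector.subspace_span)

lemma csubspace_vimage:
  "bounded_clinear T \<Longrightarrow> csubspace V \<Longrightarrow> csubspace {x. T x \<in> V}"
  by (auto intro!: complex_vector.subspaceI simp: bounded_clinear_simps complex_vector.subspace_0
      complex_vector.subspace_add complex_vector.subspace_scale)

lemma csubspace_equalizer:
  "bounded_clinear F \<Longrightarrow> bounded_clinear G \<Longrightarrow> csubspace {x. F x = G x}"
  by (auto intro!: complex_vector.subspaceI simp: bounded_clinear_simps)

lemma csubspace_image: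
  "bounded_clinear T \<Longrightarrow> csubspace V \<Longrightarrow> csubspace (T ` V)"
proof (rule complex_vector.subspaceI)
  assume T: "bounded_clinear T" and V: "csubspace V"
  show "0 \<in> T ` V"
    by (metis T V bounded_clinear_simps(4) complex_vector.subspace_0 image_eqI)
  show "x + y \<in> T ` V" if "x \<in> T ` V" "y \<in> T ` V" for x y
    using that complex_vector.subspace_add[OF V] bounded_clinear_simps(1)[OF T, symmetric] by auto
  show "c *\<^sub>C x \<in> T ` V" if "x \<in> T ` V" for c x
    using that complex_vector.subspace_scale[OF V] bounded_clinear_simps(5)[OF T, symmetric] by auto
qed

text \<open>Preimages in \<open>V\<close> of a convergent sequence of images form a Cauchy sequence,
  whose limit lies in \<open>V\<close> by completeness. Norm preservation is asked on
  \<open>V\<close> only, so that the lemma applies to the identification \<open>U\<close>, which is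
  shown to be isometric on \<open>K\<close> alone.\<close>

lemma closed_isometric_image:
  fixes T :: "'a::complex_hilbert \<Rightarrow> 'b::complex_inner"
  assumes T: "bounded_clinear T" and V: "csubspace V" "closed V"
    and iso: "\<And>x. x \<in> V \<Longrightarrow> norm (T x) = norm x"
  shows "closed (T ` V)"
proof -
  have "y \<in> T ` V" if f: "\<And>i. f i \<in> T ` V" and lim: "f \<longlonglongrightarrow> y" for f :: "nat \<Rightarrow> 'b" and y
  proof -
    have "\<forall>i. \<exists>x. x \<in> V \<and> f i = T x"
      using f by blast
    then obtain g where g: "\<And>i. g i \<in> V" "\<And>i. f i = T (g i)"
      by metis
    have "dist (g i) (g j) = dist (f i) (f j)" for i j
      using iso[OF complex_vector.subspace_diff[OF V(1) g(1) g(1)]]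
      by (simp add: dist_norm g(2) bounded_clinear_simps(2)[OF T])
    moreover have "Cauchy f"
      using lim by (rule LIMSEQ_imp_Cauchy)
    ultimately have "Cauchy g"
      unfolding Cauchy_def by simp
    then obtain x where x: "g \<longlonglongrightarrow> x"
      using Cauchy_convergent_iff convergent_def by blast
    then have "x \<in> V"
      using V(2) g(1) closed_sequentially by blast
    moreover have "(\<lambda>i. T (g i)) \<longlonglongrightarrow> T x"
      by (rule bounded_clinear_tendsto[OF T x])
    moreover have "f = (\<lambda>i. T (g i))"
      using g(2) by blast
    ultimately show ?thesis
      using lim LIMSEQ_unique by blast
  qed
  then show ?thesis
    unfolding closed_sequential_limits by blast
qed

text \<open>The adjoint is carried along as a second operator, because \<open>cadjoint\<close> is a
  definite description and would first require an existence proof. A representation supplies the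
  partner of \<open>\<pi> x\<close> as \<open>\<pi> (adj B x)\<close>.\<close>

definition adjoint_pair :: "('h::complex_inner \<Rightarrow> 'h) \<Rightarrow> ('h \<Rightarrow> 'h) \<Rightarrow> bool"
  where "adjoint_pair T T' \<longleftrightarrow>
    bounded_clinear T \<and> bounded_clinear T' \<and> (\<forall>x y. cinner (T x) y = cinner x (T' y))"

lemma adjoint_pair_sym: "adjoint_pair T T' \<Longrightarrow> adjoint_pair T' T"
  unfolding adjoint_pair_def by (metis cinner_commute)

lemma adjoint_pair_cinner: "adjoint_pair T T' \<Longrightarrow> cinner (T x) y = cinner x (T' y)"
  by (simp add: adjoint_pair_def)

lemma adjoint_pair_funpow: "adjoint_pair T T' \<Longrightarrow> adjoint_pair (T ^^ k) (T' ^^ k)"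
proof (induction k)
  case (Suc k)
  then have "adjoint_pair (T ^^ k) (T' ^^ k)" by simp
  then show ?case
    using Suc.prems unfolding adjoint_pair_def
    by (auto intro: bounded_clinear_funpow bounded_clinear_comp simp flip: funpow_swap1)
qed (simp add: adjoint_pair_def bounded_clinear_id)

section \<open>The unitary attached to a pair of twisted commuting isometries\<close>

locale isometry =
  fixes V V' :: "'h::complex_inner \<Rightarrow> 'h"
  assumes adjoint: "adjoint_pair V V'"
    and left_inverse: "V' (V x) = x"
begin

lemma bounded_clinear: "bounded_clinear V" "bounded_clinear V'"
  using adjoint by (simp_all add: adjoint_pair_def)

lemmas linear_simps = bounded_clinear[THEN bounded_clinear_simps(1)]
  bounded_clinear[THEN bounded_clinear_simps(2)] bounded_clinear[THEN bounded_clinear_simps(3)]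
  bounded_clinear[THEN bounded_clinear_simps(4)] bounded_clinear[THEN bounded_clinear_simps(5)]

lemma cinner_left: "cinner (V x) y = cinner x (V' y)"
  by (rule adjoint_pair_cinner[OF adjoint])

lemma cinner_right: "cinner x (V y) = cinner (V' x) y"
  by (rule adjoint_pair_cinner[OF adjoint_pair_sym[OF adjoint], symmetric])

lemma norm_isometry: "norm (V x) = norm x"
proof -
  have "complex_of_real ((norm (V x))\<^sup>2) = complex_of_real ((norm x)\<^sup>2)"
    unfolding cinner_self[symmetric] by (simp add: cinner_left left_inverse)
  then show ?thesis
    using of_real_eq_iff by (metis norm_ge_zero power2_eq_iff_nonneg)
qed

lemma inj: "V x = V y \<Longrightarrow> x = y"
  by (metis left_inverse)

end

locale isometry_pair = V: isometry V V' + W: isometry W W'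
  for V V' W W' :: "'h::complex_inner \<Rightarrow> 'h" +
  fixes c :: complex
  assumes cmod_c: "cmod c = 1"
    and twist: "V (W x) = c *\<^sub>C W (V x)"
begin

definition defect :: "'h \<Rightarrow> 'h" where "defect x = x - V (W (W' (V' x)))"
text \<open>The formula makes sense on the whole space. It vanishes on the range of
  \<open>V W\<close> and takes its values in the defect space, so its only nontrivial part is an
  operator on the defect space.\<close>

definition u :: "'h \<Rightarrow> 'h" where "u x = V (x - W (W' x)) + (W' x - V (V' (W' x)))"
definition u_adj :: "'h \<Rightarrow> 'h" where "u_adj x = (V' x - W (W' (V' x))) + W (x - V (V' x))"
definition p :: "'h \<Rightarrow> 'h" where "p x = W (W' x - V (V' (W' x)))"

lemmas op_simps = V.linear_simps W.linear_simps V.left_inverse W.left_inverse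

lemma twist_adjoint: "W' (V' x) = cnj c *\<^sub>C V' (W' x)"
proof (rule cinner_ext)
  fix z
  have "cinner z (W' (V' x)) = cinner (V (W z)) x"
    by (simp add: V.cinner_left W.cinner_left)
  then show "cinner z (W' (V' x)) = cinner z (cnj c *\<^sub>C V' (W' x))"
    by (simp add: twist cinner_scaleC_left cinner_scaleC_right V.cinner_left W.cinner_left)
qed

lemma c_cnj: "c * cnj c = 1"
  using cmod_c by (metis complex_norm_square mult_1 of_real_1 power2_eq_square)

text \<open>The scalars from exchanging \<open>V\<close> with \<open>W\<close> and \<open>V'\<close>
  with \<open>W'\<close> are conjugate and unimodular, so they cancel. Thus \<open>defect\<close> is
  symmetric in the two isometries, which gives the defect space its two orthogonal
  decompositions.\<close>

lemma range_projection_swap: "V (W (W' (V' x))) = W (V (V' (W' x)))"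
  by (simp add: twist twist_adjoint op_simps scaleC_scaleC c_cnj scaleC_one mult.commute)

text \<open>The defect space is the kernel of the adjoint of \<open>V W\<close>; as \<open>c\<close>
  is nonzero, it is also the kernel of the adjoint of \<open>W V\<close>. Both equations are what
  the later computations on the defect space use.\<close>

lemma in_range_defect:
  assumes "y \<in> range defect"
  shows "W' (V' y) = 0" "V' (W' y) = 0"
proof -
  obtain x where "y = x - V (W (W' (V' x)))"
    using assms by (auto simp: defect_def)
  then show "W' (V' y) = 0"
    by (simp add: op_simps)
  moreover have "c \<noteq> 0"
    using c_cnj by auto
  ultimately show "V' (W' y) = 0"
    by (simp add: twist_adjoint)
qed

lemma in_range_defectI: "W' (V' y) = 0 \<Longrightarrow> y \<in> range defect"
  by (rule range_eqI[of _ _ y]) (simp add: defect_def op_simps)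

lemma bounded_clinear_p: "bounded_clinear p" and bounded_clinear_u: "bounded_clinear u"
  unfolding p_def[abs_def] u_def[abs_def]
  by (rule V.bounded_clinear W.bounded_clinear bounded_clinear_ident bounded_clinear_add
      bounded_clinear_sub bounded_clinear_compose[of V] bounded_clinear_compose[of W]
      bounded_clinear_compose[of V'] bounded_clinear_compose[of W'])+

lemma u_vanishes: "u (W (V x)) = 0" and p_vanishes: "p (W (V x)) = 0"
  by (simp_all add: u_def p_def op_simps)

lemma adjoint_u_vanishes: "W' (V' (u x)) = 0" and adjoint_p_vanishes: "V' (W' (p x)) = 0"
  by (simp_all add: u_def p_def op_simps)

lemma u_in_range: "u x \<in> range defect"
  by (rule in_range_defectI) (rule adjoint_u_vanishes)

lemma p_in_range: "p x \<in> range defect"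
  by (rule in_range_defectI) (simp add: twist_adjoint adjoint_p_vanishes)

text \<open>Together the two equations give commutation with the defect projection: both composites
  equal \<open>u\<close>. The first holds because the adjoint of \<open>V W\<close> kills the range
  of \<open>u\<close>, the second because \<open>u\<close> kills the range of
  \<open>W V\<close>.\<close>

lemma defect_u: "defect (u x) = u x" and u_defect: "u (defect x) = u x"
  by (simp_all add: defect_def adjoint_u_vanishes op_simps)
     (simp add: range_projection_swap bounded_clinear_simps[OF bounded_clinear_u] u_vanishes)

lemma defect_p: "defect (p x) = p x" and p_defect: "p (defect x) = p x"
  by (simp_all add: defect_def range_projection_swap adjoint_p_vanishes op_simps
      bounded_clinear_simps[OF bounded_clinear_p] p_vanishes)

lemma csubspace_range_defect: "csubspace (range defect)"
  and closed_range_defect: "closed (range defect)"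
proof -
  have eq: "range defect = {x. W' (V' x) = (\<lambda>_. 0) x}"
    using in_range_defect(1) in_range_defectI by auto
  have lin: "bounded_clinear (\<lambda>x. W' (V' x))" "bounded_clinear (\<lambda>_::'h. 0::'h)"
    by (rule bounded_clinear_compose[OF W.bounded_clinear(2) V.bounded_clinear(2)])
       (simp add: bounded_clinearI[where b = 0])
  show "csubspace (range defect)"
    unfolding eq by (rule csubspace_equalizer[OF lin])
  show "closed (range defect)"
    unfolding eq by (intro closed_equalizer bounded_clinear_continuous lin)
qed

text \<open>On the defect space \<open>u_adj y\<close> reduces to
  \<open>V' y + W (y - V (V' y))\<close>. Then \<open>u\<close> sends the first summand to
  \<open>V (V' y)\<close> and the second to \<open>y - V (V' y)\<close>, which add up to
  \<open>y\<close>.\<close>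

lemma u_u_adj:
  assumes "y \<in> range defect"
  shows "u (u_adj y) = y"
  using in_range_defect[OF assms] by (simp add: u_def u_adj_def op_simps)

lemma u_adj_u:
  assumes "y \<in> range defect"
  shows "u_adj (u y) = y"
  using in_range_defect[OF assms] by (simp add: u_def u_adj_def op_simps)

lemma cinner_u: "cinner (u x) y = cinner x (u_adj y)"
  by (simp add: u_def u_adj_def op_simps cinner_add_left cinner_diff_left cinner_add_right
      cinner_diff_right V.cinner_left W.cinner_left V.cinner_right W.cinner_right)

lemma unitary_u: "unitary_on (range defect) u"
  unfolding unitary_between_def
proof (intro conjI csubspace_range_defect closed_range_defect ballI allI)
  have "y \<in> u ` range defect" if "y \<in> range defect" for y
    using u_u_adj[OF that] u_defect[of "u_adj y"] by (metis image_eqI rangeI)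
  then show "u ` range defect = range defect"
    using u_in_range by auto
  show "cinner (u x) (u y) = cinner x y" if "y \<in> range defect" for x y
    using that by (simp add: cinner_u u_adj_u)
qed (simp_all add: bounded_clinear_simps[OF bounded_clinear_u])

lemma projection_p: "projection_on (range defect) p"
  unfolding projection_on_def
proof (intro conjI csubspace_range_defect closed_range_defect ballI allI)
  show "p ` range defect \<subseteq> range defect"
    using p_in_range by auto
  show "p (p x) = p x" for x
    by (simp add: p_def op_simps)
  show "cinner (p x) y = cinner x (p y)" for x y
    by (simp add: p_def op_simps cinner_diff_left
        cinner_diff_right V.cinner_left W.cinner_left V.cinner_right W.cinner_right)
qed (simp_all add: bounded_clinear_simps[OF bounded_clinear_p])

text \<open>For \<open>y\<close> in the defect space, \<open>p y = W (W' y)\<close>,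
  \<open>u (p y) = W' y\<close> and \<open>u (y - p y) = V (y - W (W' y))\<close>. The claim is
  \<open>V\<close> applied to the splitting of \<open>y\<close> along the range of
  \<open>W\<close>.\<close>

lemma decomposition:
  assumes "y \<in> range defect"
  shows "V y = V (W (u (p y))) + u (y - p y)"
  using in_range_defect[OF assms] by (simp add: u_def p_def op_simps)

text \<open>If \<open>V\<close> is onto, \<open>V' (W' y) = 0\<close> forces
  \<open>W' y = 0\<close>, and only the term \<open>V y\<close> of \<open>u y\<close>
  survives.\<close>

lemma unitary_decomposition:
  assumes "y \<in> range defect" "\<And>x. V (V' x) = x"
  shows "V y = u y"
proof -
  have "W' y = 0"
    using in_range_defect(2)[OF assms(1)] assms(2)[of "W' y"] by (simp add: op_simps)
  then show ?thesis
    by (simp add: u_def op_simps)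
qed

end

section \<open>Operators on square-summable sequences\<close>

text \<open>Since \<open>tensor_op\<close> is a definite description, nothing is known about it
  before some bounded operator with the right values on elementary tensors is exhibited;
  \<open>C\<close> is such a witness.\<close>

lemma tensor_op_elementary:
  fixes T :: "'h \<Rightarrow> 'h::complex_inner"
  assumes "bounded_clinear C" "\<And>x h. C (x \<otimes>\<^sub>e h) = A x \<otimes>\<^sub>e T h"
  shows "bounded_clinear (A \<otimes>\<^sub>o\<^sub>p T)" "(A \<otimes>\<^sub>o\<^sub>p T) (x \<otimes>\<^sub>e h) = A x \<otimes>\<^sub>e T h"
  using assms tensor_op_eqI[OF assms] by simp_all

lemma tens_scaleC_left: "(c *\<^sub>C x) \<otimes>\<^sub>e h = c *\<^sub>C (x \<otimes>\<^sub>e h)"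
  by (rule l2_eqI) (simp add: tens.rep_eq scaleC_l2.rep_eq scaleC_complex_def scaleC_scaleC)

lemma cinner_basis_tens: "cinner f (l2_basis l \<otimes>\<^sub>e h) = cinner (l2_nth f l) h"
proof -
  have "(\<lambda>i. cinner (l2_nth f i) (l2_nth (l2_basis l \<otimes>\<^sub>e h) i)) =
      (\<lambda>i. if i = l then cinner (l2_nth f i) h else 0)"
    by (auto simp: tens.rep_eq l2_basis.rep_eq scaleC_one cinner_scaleC_right)
  then show ?thesis
    unfolding cinner_l2_def using sums_single[of l "\<lambda>i. cinner (l2_nth f i) h"]
    by (simp add: sums_iff)
qed

lemma l2_norm_le:
  assumes "\<And>l. norm (l2_nth f l) \<le> norm (l2_nth g l) * b" "b \<ge> 0"
  shows "norm f \<le> norm g * b"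
proof -
  have "(norm f)\<^sup>2 \<le> (\<Sum>l. (norm (l2_nth g l))\<^sup>2 * b\<^sup>2)"
    unfolding norm_l2_square
    by (intro suminf_le summable_l2_nth summable_mult2)
       (metis assms(1) norm_ge_zero power_mono power_mult_distrib)
  also have "\<dots> = (norm g * b)\<^sup>2"
    by (simp add: norm_l2_square power_mult_distrib suminf_mult2[OF summable_l2_nth, symmetric])
  finally show ?thesis
    using assms(2) by (simp add: power2_le_iff_abs_le)
qed

text \<open>The entries may be vectors: for complex entries this is the adjoint of
  \<open>l2_shift\<close>, and for entries in a Hilbert space it is the tensor product of that
  adjoint with the identity.\<close>

lift_definition l2_right_shift :: "'h::complex_inner l2 \<Rightarrow> 'h l2"
  is "\<lambda>f l. case l of 0 \<Rightarrow> 0 | Suc l \<Rightarrow> f l"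
  by (subst summable_Suc_iff[symmetric]) simp

lemma l2_right_shift_nth:
  "l2_nth (l2_right_shift f) 0 = 0" "l2_nth (l2_right_shift f) (Suc l) = l2_nth f l"
  by (simp_all add: l2_right_shift.rep_eq)

lemma cadjoint_l2_shift: "cadjoint l2_shift = l2_right_shift"
proof (rule cadjoint_eqI)
  fix x y :: "complex l2"
  have "cinner x (l2_right_shift y) =
      (\<Sum>l. cinner (l2_nth x (Suc l)) (l2_nth (l2_right_shift y) (Suc l)))"
    unfolding cinner_l2_def
    by (subst suminf_split_head[OF summable_cinner])
       (simp add: l2_right_shift_nth cinner_zero)
  then show "cinner (l2_shift x) y = cinner x (l2_right_shift y)"
    by (simp add: cinner_l2_def l2_right_shift_nth l2_shift.rep_eq)
qed

lemma bounded_clinear_l2_right_shift: "bounded_clinear l2_right_shift"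
proof (rule bounded_clinearI[where b = 1])
  fix f g :: "'a l2" and c
  show "l2_right_shift (f + g) = l2_right_shift f + l2_right_shift g"
    by (rule l2_eqI, case_tac l) (simp_all add: l2_right_shift_nth plus_l2.rep_eq)
  show "l2_right_shift (c *\<^sub>C f) = c *\<^sub>C l2_right_shift f"
    by (rule l2_eqI, case_tac l) (simp_all add: l2_right_shift_nth scaleC_l2.rep_eq)
  have "(norm (l2_right_shift f))\<^sup>2 = (norm f)\<^sup>2"
    using suminf_split_head[OF summable_l2_nth[of "l2_right_shift f"]]
    by (simp add: norm_l2_square l2_right_shift_nth)
  then show "norm (l2_right_shift f) \<le> norm f * 1"
    by (simp add: power2_eq_iff_nonneg)
qed

lemma l2_right_shift_tens: "l2_right_shift (x \<otimes>\<^sub>e h) = l2_right_shift x \<otimes>\<^sub>e h"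
  by (rule l2_eqI, case_tac l) (simp_all add: l2_right_shift_nth tens.rep_eq)

lemma l2_right_shift_basis: "l2_right_shift (l2_basis l) = l2_basis (Suc l)"
  by (rule l2_eqI, case_tac la) (simp_all add: l2_right_shift_nth l2_basis.rep_eq)

text \<open>The value is junk unless the sequence is square-summable; see \<open>l2_map_nth\<close>.\<close>

definition l2_map :: "(nat \<Rightarrow> complex) \<Rightarrow> ('h \<Rightarrow> 'h) \<Rightarrow> 'h::complex_inner l2 \<Rightarrow> 'h l2"
  where "l2_map w T f = Abs_l2 (\<lambda>l. w l *\<^sub>C T (l2_nth f l))"

lemma
  assumes T: "bounded_clinear T" and w: "\<And>l. cmod (w l) \<le> 1"
  shows l2_map_nth: "l2_nth (l2_map w T f) l = w l *\<^sub>C T (l2_nth f l)"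
    and bounded_clinear_l2_map: "bounded_clinear (l2_map w T)"
proof -
  obtain b where b: "b > 0" "\<And>x. norm (T x) \<le> norm x * b"
    using T bounded_linear.pos_bounded unfolding bounded_clinear_def by blast
  have le: "norm (w l *\<^sub>C T x) \<le> norm x * b" for l x
    using mult_mono[OF w[of l] b(2)[of x]] by (simp add: norm_scaleC)
  have "summable (\<lambda>l. (norm (w l *\<^sub>C T (l2_nth f l)))\<^sup>2)" for f
  proof (rule summable_comparison_test')
    show "summable (\<lambda>l. (norm (l2_nth f l))\<^sup>2 * b\<^sup>2)"
      by (intro summable_mult2 summable_l2_nth)
    show "norm ((norm (w l *\<^sub>C T (l2_nth f l)))\<^sup>2) \<le> (norm (l2_nth f l))\<^sup>2 * b\<^sup>2" for l
      using power_mono[OF le norm_ge_zero, of l "l2_nth f l" 2] by (simp add: power_mult_distrib)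
  qed
  then show nth: "l2_nth (l2_map w T f) l = w l *\<^sub>C T (l2_nth f l)" for f l
    by (simp add: l2_map_def Abs_l2_inverse)
  show "bounded_clinear (l2_map w T)"
    using le b(1)
    by (intro bounded_clinearI[where b = b] l2_eqI l2_norm_le)
       (simp_all add: nth plus_l2.rep_eq scaleC_l2.rep_eq bounded_clinear_simps[OF T]
         scaleC_add_right scaleC_scaleC mult.commute)
qed

section \<open>Diagonal operators and their tensor products\<close>

lemma cadjoint_power_N:
  assumes "cmod c \<le> 1"
  shows "cadjoint (power_N c) = power_N (cnj c)"
  using assms
  by (intro cadjoint_eqI) (simp add: cinner_l2_def power_N.rep_eq cinner_complex_def mult_ac)

lemma compose_list_power_N_nth:
  assumes "\<And>i. i \<in> set xs \<Longrightarrow> cmod (f i) \<le> 1"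
  shows "l2_nth (compose_list (map (\<lambda>i. power_N (f i)) xs) x) l = prod_list (map f xs) ^ l * l2_nth x l"
  using assms
  by (induction xs) (simp_all add: compose_list_def power_N.rep_eq power_mult_distrib)

lemma cmod_twist: "cmod (twist \<theta> i j) = 1"
  by (simp add: twist_def)

text \<open>The number whose powers are the diagonal entries of \<open>diag_op\<close>. It is also
  the scalar that appears when \<open>s k\<close> moves past \<open>s 1, ..., s M\<close>, see
  \<open>generator_all\<close>.\<close>

definition twist_factor :: "(nat \<Rightarrow> nat \<Rightarrow> real) \<Rightarrow> nat \<Rightarrow> nat \<Rightarrow> complex"
  where "twist_factor \<theta> M k =
    prod_list (map (\<lambda>i. cnj (twist \<theta> i k)) [1..<k]) * prod_list (map (twist \<theta> k) [k+1..<Suc M])"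

lemma cmod_prod_list_eq_1:
  "(\<And>i. i \<in> set xs \<Longrightarrow> cmod (f i) = 1) \<Longrightarrow> cmod (prod_list (map f xs)) = 1"
  by (induction xs) (simp_all add: norm_mult)

lemma cmod_twist_factor: "cmod (twist_factor \<theta> M k) = 1"
  unfolding twist_factor_def norm_mult by (simp add: cmod_prod_list_eq_1 cmod_twist)

lemma diag_op_nth: "l2_nth (diag_op \<theta> M k x) l = twist_factor \<theta> M k ^ l * l2_nth x l"
  unfolding diag_op_def twist_factor_def
  by (simp add: cadjoint_power_N cmod_twist compose_list_power_N_nth power_mult_distrib
      del: upt_Suc)

lemma diag_op_basis: "diag_op \<theta> M k (l2_basis l) = (twist_factor \<theta> M k ^ l) *\<^sub>C l2_basis l"
  by (rule l2_eqI) (simp add: diag_op_nth l2_basis.rep_eq scaleC_l2.rep_eq scaleC_complex_def)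

text \<open>The witnesses are \<open>l2_map\<close> with weights the powers of
  \<open>twist_factor\<close>, and a multiple of its composite with \<open>l2_right_shift\<close>.
  The values at basis tensors suffice later, since \<open>U\<close> sends the vectors spanning
  \<open>K\<close> to such tensors.\<close>

lemma
  fixes T :: "'h \<Rightarrow> 'h::complex_inner"
  assumes T: "bounded_clinear T"
  shows bounded_clinear_diag_op_tensor: "bounded_clinear (diag_op \<theta> M k \<otimes>\<^sub>o\<^sub>p T)"
    and diag_op_tensor_basis: "(diag_op \<theta> M k \<otimes>\<^sub>o\<^sub>p T) (l2_basis l \<otimes>\<^sub>e h) =
      (twist_factor \<theta> M k ^ l) *\<^sub>C (l2_basis l \<otimes>\<^sub>e T h)"
    and bounded_clinear_shift_diag_op_tensor: "bounded_clinear
      ((\<lambda>x. c *\<^sub>C cadjoint l2_shift (diag_op \<theta> M k x)) \<otimes>\<^sub>o\<^sub>p T)"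
    and shift_diag_op_tensor_basis:
      "((\<lambda>x. c *\<^sub>C cadjoint l2_shift (diag_op \<theta> M k x)) \<otimes>\<^sub>o\<^sub>p T) (l2_basis l \<otimes>\<^sub>e h) =
        (c * twist_factor \<theta> M k ^ l) *\<^sub>C (l2_basis (Suc l) \<otimes>\<^sub>e T h)"
proof -
  let ?w = "twist_factor \<theta> M k"
  have w: "cmod (?w ^ l) \<le> 1" for l
    by (simp add: norm_power cmod_twist_factor)
  note map = l2_map_nth[OF T w] bounded_clinear_l2_map[OF T w]
  have tens: "l2_map (\<lambda>l. ?w ^ l) T (x \<otimes>\<^sub>e h) = diag_op \<theta> M k x \<otimes>\<^sub>e T h" for x h
    by (rule l2_eqI)
       (simp add: map(1) tens.rep_eq diag_op_nth bounded_clinear_simps(5)[OF T] scaleC_scaleC)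
  note D = tensor_op_elementary[OF map(2) tens]
  show "bounded_clinear (diag_op \<theta> M k \<otimes>\<^sub>o\<^sub>p T)"
    by (rule D(1))
  show "(diag_op \<theta> M k \<otimes>\<^sub>o\<^sub>p T) (l2_basis l \<otimes>\<^sub>e h) = (?w ^ l) *\<^sub>C (l2_basis l \<otimes>\<^sub>e T h)"
    unfolding D(2) by (simp add: diag_op_basis tens_scaleC_left)
  have lin: "bounded_clinear (\<lambda>f. c *\<^sub>C l2_right_shift (l2_map (\<lambda>l. ?w ^ l) T f))"
    by (intro bounded_clinear_compose[OF bounded_clinear_scaleC]
        bounded_clinear_compose[OF bounded_clinear_l2_right_shift] map(2))
  have tens': "c *\<^sub>C l2_right_shift (l2_map (\<lambda>l. ?w ^ l) T (x \<otimes>\<^sub>e h)) =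
      (c *\<^sub>C cadjoint l2_shift (diag_op \<theta> M k x)) \<otimes>\<^sub>e T h" for x h
    by (simp add: tens l2_right_shift_tens cadjoint_l2_shift tens_scaleC_left)
  note S = tensor_op_elementary[OF lin tens']
  show "bounded_clinear ((\<lambda>x. c *\<^sub>C cadjoint l2_shift (diag_op \<theta> M k x)) \<otimes>\<^sub>o\<^sub>p T)"
    by (rule S(1))
  show "((\<lambda>x. c *\<^sub>C cadjoint l2_shift (diag_op \<theta> M k x)) \<otimes>\<^sub>o\<^sub>p T) (l2_basis l \<otimes>\<^sub>e h) =
      (c * ?w ^ l) *\<^sub>C (l2_basis (Suc l) \<otimes>\<^sub>e T h)"
    unfolding S(2)
    by (simp add: diag_op_basis cadjoint_l2_shift l2_right_shift_basis tens_scaleC_left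
        bounded_clinear_simps[OF bounded_clinear_l2_right_shift] scaleC_scaleC)
qed

lemma shift_tensor_id: "cadjoint l2_shift \<otimes>\<^sub>o\<^sub>p id = l2_right_shift"
  unfolding cadjoint_l2_shift
  by (rule tensor_op_eqI[OF bounded_clinear_l2_right_shift]) (simp add: l2_right_shift_tens)

text \<open>The truncations of \<open>f\<close> are finite sums of elementary tensors with vectors
  from \<open>V\<close>, and they converge to \<open>f\<close>.\<close>

lemma l2_tensor_coordinatewise:
  assumes "\<And>l. l2_nth f l \<in> V"
  shows "f \<in> l2_tensor V"
  unfolding l2_tensor_def closure_sequential using assms
  by (intro exI[of _ "\<lambda>N. \<Sum>l<N. l2_basis l \<otimes>\<^sub>e l2_nth f l"] conjI allI l2_truncation_tendsto
      complex_vector.span_sum complex_vector.span_base) auto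

section \<open>The Wold decomposition of an isometry\<close>

locale wold = isometry a a' for a a' :: "'h::complex_hilbert \<Rightarrow> 'h"
begin

definition P :: "'h \<Rightarrow> 'h" where "P x = x - a (a' x)"

definition K :: "'h set" where "K = closure (cspan {(a ^^ l) \<eta> |l \<eta>. \<eta> \<in> range P})"

definition H0 :: "'h set" where "H0 = unitary_part a"

definition U :: "'h \<Rightarrow> 'h l2" where "U h = Abs_l2 (\<lambda>l. P ((a' ^^ l) h))"

lemma defect_projection_eq: "defect_projection a = P"
proof -
  have "cadjoint a = a'"
    by (rule cadjoint_eqI) (rule cinner_left)
  then show ?thesis
    by (simp add: defect_projection_def P_def[abs_def])
qed

lemma shift_part_eq: "shift_part a = K"
  by (simp add: shift_part_def K_def defect_projection_eq)

lemma range_P: "\<eta> \<in> range P \<longleftrightarrow> a' \<eta> = 0"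
proof
  assume "\<eta> \<in> range P"
  then show "a' \<eta> = 0"
    by (auto simp: P_def linear_simps left_inverse)
next
  assume "a' \<eta> = 0"
  then show "\<eta> \<in> range P"
    by (intro range_eqI[of _ _ \<eta>]) (simp add: P_def linear_simps)
qed

lemma P_range: "\<eta> \<in> range P \<Longrightarrow> P \<eta> = \<eta>"
  unfolding range_P by (simp add: P_def linear_simps)

lemma bounded_clinear_P: "bounded_clinear P"
  unfolding P_def[abs_def]
  by (intro bounded_clinear_sub bounded_clinear_ident
      bounded_clinear_compose[OF bounded_clinear])

lemma norm_P: "(norm (P x))\<^sup>2 = (norm x)\<^sup>2 - (norm (a' x))\<^sup>2"
proof -
  have "complex_of_real ((norm (P x))\<^sup>2) = complex_of_real ((norm x)\<^sup>2 - (norm (a' x))\<^sup>2)"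
    unfolding of_real_diff cinner_self[symmetric]
    by (simp add: P_def cinner_diff_left cinner_diff_right cinner_left cinner_right left_inverse
        linear_simps cinner_zero)
  then show ?thesis
    using of_real_eq_iff by blast
qed

text \<open>By \<open>norm_P\<close> each term is the drop in squared norm from one power of
  \<open>a'\<close> to the next, so the partial sums telescope and stay below the squared norm of
  \<open>h\<close>. This makes \<open>U h\<close> square-summable and \<open>U\<close> a
  contraction.\<close>

lemma P_sums_le:
  "summable (\<lambda>l. (norm (P ((a' ^^ l) h)))\<^sup>2)"
  "(\<Sum>l. (norm (P ((a' ^^ l) h)))\<^sup>2) \<le> (norm h)\<^sup>2"
proof -
  let ?g = "\<lambda>l. (norm ((a' ^^ l) h))\<^sup>2"
  have sum: "(\<Sum>l<N. (norm (P ((a' ^^ l) h)))\<^sup>2) \<le> (norm h)\<^sup>2" for N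
    using sum_lessThan_telescope'[of ?g N] by (simp add: norm_P)
  then show 1: "summable (\<lambda>l. (norm (P ((a' ^^ l) h)))\<^sup>2)"
    by (intro summableI_nonneg_bounded) simp_all
  show "(\<Sum>l. (norm (P ((a' ^^ l) h)))\<^sup>2) \<le> (norm h)\<^sup>2"
    using suminf_le_const[OF 1] sum by simp
qed

lemma U_nth: "l2_nth (U h) l = P ((a' ^^ l) h)"
  using P_sums_le(1)[of h] by (simp add: U_def Abs_l2_inverse)

lemma bounded_clinear_U: "bounded_clinear U"
proof (rule bounded_clinearI[where b = 1])
  fix x y c
  note lin = bounded_clinear_simps[OF bounded_clinear_funpow[OF bounded_clinear(2)]]
    bounded_clinear_simps[OF bounded_clinear_P]
  show "U (x + y) = U x + U y" "U (c *\<^sub>C x) = c *\<^sub>C U x"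
    by (simp_all add: l2_eqI U_nth lin plus_l2.rep_eq scaleC_l2.rep_eq)
  have "(norm (U x))\<^sup>2 \<le> (norm x)\<^sup>2"
    unfolding norm_l2_square U_nth by (rule P_sums_le(2))
  then show "norm (U x) \<le> norm x * 1"
    by (simp add: power2_le_iff_abs_le)
qed

lemma funpow_left_inverse: "(a' ^^ k) ((a ^^ k) x) = x"
  by (induction k arbitrary: x) (simp_all add: left_inverse funpow_swap1[of a'])

text \<open>Coordinate \<open>l\<close> is \<open>P\<close> applied to
  \<open>(a' ^^ l) ((a ^^ k) \<eta>)\<close>. For \<open>l < k\<close> a positive power of
  \<open>a\<close> is left, which \<open>P\<close> kills; for \<open>l > k\<close> a positive power
  of \<open>a'\<close> is left, which kills \<open>\<eta>\<close>.\<close>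

lemma U_basis:
  assumes "\<eta> \<in> range P"
  shows "U ((a ^^ k) \<eta>) = l2_basis k \<otimes>\<^sub>e \<eta>"
proof (rule l2_eqI)
  fix l
  have zero: "(a' ^^ Suc i) \<eta> = 0" "P 0 = 0" for i
    using assms unfolding range_P
    by (simp_all add: funpow_swap1 P_def linear_simps
        bounded_clinear_simps[OF bounded_clinear_funpow[OF bounded_clinear(2)]])
  show "l2_nth (U ((a ^^ k) \<eta>)) l = l2_nth (l2_basis k \<otimes>\<^sub>e \<eta>) l"
  proof (cases l k rule: linorder_cases)
    case less
    then obtain i where "k = l + Suc i"
      using less_imp_Suc_add by auto
    then have "(a' ^^ l) ((a ^^ k) \<eta>) = (a ^^ Suc i) \<eta>"
      by (simp only: funpow_add comp_apply funpow_left_inverse)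
    then show ?thesis
      using less by (simp add: U_nth tens.rep_eq l2_basis.rep_eq P_def left_inverse)
  next
    case equal
    then show ?thesis
      by (simp add: U_nth tens.rep_eq l2_basis.rep_eq funpow_left_inverse P_range[OF assms])
  next
    case greater
    then obtain i where "l = Suc i + k"
      using less_imp_Suc_add[OF greater] by (auto simp: add.commute)
    then have "(a' ^^ l) ((a ^^ k) \<eta>) = 0"
      by (simp only: funpow_add comp_apply funpow_left_inverse zero)
    then show ?thesis
      using greater zero(2) by (simp add: U_nth tens.rep_eq l2_basis.rep_eq)
  qed
qed

lemma csubspace_K: "csubspace K" and closed_K: "closed K"
  unfolding K_def by (simp_all add: csubspace_closure_cspan)

lemma in_K: "\<eta> \<in> range P \<Longrightarrow> (a ^^ l) \<eta> \<in> K"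
  unfolding K_def using subset_closure_cspan by fast

lemma K_subset:
  assumes "\<And>l \<eta>. \<eta> \<in> range P \<Longrightarrow> (a ^^ l) \<eta> \<in> V" "csubspace V" "closed V"
  shows "K \<subseteq> V"
  unfolding K_def using assms by (intro closure_cspan_subset) auto

text \<open>The condition on \<open>y\<close> is linear and closed, so generators of
  \<open>K\<close> suffice. Pairing with the basis tensor of \<open>\<eta>\<close> at
  \<open>l\<close> picks out coordinate \<open>l\<close> of \<open>U x\<close>, and the
  \<open>P\<close> in it disappears because \<open>a' \<eta> = 0\<close>.\<close>

lemma cinner_U:
  assumes "y \<in> K"
  shows "cinner (U x) (U y) = cinner x y"
proof -
  have "K \<subseteq> {y. cinner (U x) (U y) = cinner x y}"
  proof (rule K_subset)
    fix l \<eta> assume \<eta>: "\<eta> \<in> range P"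
    then have "a' \<eta> = 0"
      by (simp add: range_P)
    then have "cinner (U x) (U ((a ^^ l) \<eta>)) = cinner ((a' ^^ l) x) \<eta>"
      by (simp add: U_basis[OF \<eta>] cinner_basis_tens U_nth P_def cinner_diff_left cinner_left
          cinner_zero)
    also have "\<dots> = cinner x ((a ^^ l) \<eta>)"
      by (rule adjoint_pair_cinner[OF adjoint_pair_funpow[OF adjoint_pair_sym[OF adjoint]]])
    finally show "(a ^^ l) \<eta> \<in> {y. cinner (U x) (U y) = cinner x y}"
      by simp
  next
    show "csubspace {y. cinner (U x) (U y) = cinner x y}"
      by (rule complex_vector.subspaceI)
         (simp_all add: bounded_clinear_simps[OF bounded_clinear_U] cinner_add_right
           cinner_scaleC_right cinner_zero)
    show "closed {y. cinner (U x) (U y) = cinner x y}"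
      using bounded_clinear_U
      by (intro closed_equalizer linear_continuous_on bounded_linear_cinner_right
          bounded_linear_compose[OF bounded_linear_cinner_right]) (simp add: bounded_clinear_def)
  qed
  then show ?thesis
    using assms by blast
qed

lemma norm_U: "x \<in> K \<Longrightarrow> norm (U x) = norm x"
  using cinner_U[of x x] unfolding cinner_self
  by (metis norm_ge_zero of_real_eq_iff power2_eq_iff_nonneg)

lemma csubspace_range_P: "csubspace (range P)"
  by (rule csubspace_image[OF bounded_clinear_P]) simp

text \<open>The image is closed because \<open>U\<close> is isometric on \<open>K\<close>, so it is
  enough to reach elementary tensors. These are limits of truncations, each term of which is the
  image of some \<open>(a ^^ l)\<close> applied to a multiple of \<open>\<eta>\<close>.\<close>

lemma image_U: "U ` K = l2_tensor (range P)"
proof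
  show "U ` K \<subseteq> l2_tensor (range P)"
    by (auto intro!: l2_tensor_coordinatewise simp: U_nth)
next
  have closed: "closed (U ` K)" and sub: "csubspace (U ` K)"
    by (intro closed_isometric_image csubspace_image bounded_clinear_U csubspace_K closed_K norm_U;
        assumption)+
  have "x \<otimes>\<^sub>e \<eta> \<in> U ` K" if \<eta>: "\<eta> \<in> range P" for x \<eta>
  proof (rule closed_sequentially[OF closed _ l2_truncation_tendsto])
    have "l2_basis l \<otimes>\<^sub>e l2_nth (x \<otimes>\<^sub>e \<eta>) l \<in> U ` K" for l
    proof -
      have mem: "l2_nth x l *\<^sub>C \<eta> \<in> range P"
        by (rule complex_vector.subspace_scale[OF csubspace_range_P \<eta>])
      show ?thesis
        using U_basis[OF mem, of l] in_K[OF mem, of l] by (metis image_eqI tens.rep_eq)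
    qed
    then show "(\<Sum>l<N. l2_basis l \<otimes>\<^sub>e l2_nth (x \<otimes>\<^sub>e \<eta>) l) \<in> U ` K" for N
      by (simp add: complex_vector.subspace_sum[OF sub])
  qed
  then show "l2_tensor (range P) \<subseteq> U ` K"
    unfolding l2_tensor_def by (intro closure_cspan_subset sub closed) auto
qed

lemma unitary_U: "unitary_between K (l2_tensor (range P)) U"
  unfolding unitary_between_def
  by (simp add: csubspace_K closed_K image_U cinner_U bounded_clinear_simps[OF bounded_clinear_U])
     (simp add: l2_tensor_def csubspace_closure_cspan)

text \<open>Invariance of \<open>K\<close> and the intertwining relation each hold on a closed
  subspace, so both need to be tested only on the spanning vectors of \<open>K\<close>.\<close>

lemma restriction_equiv_U:
  assumes S: "bounded_clinear S" and C: "bounded_clinear C"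
    and inv: "\<And>l \<eta>. \<eta> \<in> range P \<Longrightarrow> S ((a ^^ l) \<eta>) \<in> K"
    and eq: "\<And>l \<eta>. \<eta> \<in> range P \<Longrightarrow> U (S ((a ^^ l) \<eta>)) = C (l2_basis l \<otimes>\<^sub>e \<eta>)"
  shows "restriction_equiv U K S C"
proof -
  have "K \<subseteq> {x. S x \<in> K}"
    using inv continuous_closed_vimage[OF closed_K] bounded_clinear_continuous[OF S, of UNIV]
    by (intro K_subset csubspace_vimage S csubspace_K)
       (auto simp: vimage_def continuous_on_eq_continuous_at)
  moreover have "K \<subseteq> {x. U (S x) = C (U x)}"
    using eq
    by (intro K_subset csubspace_equalizer closed_equalizer bounded_clinear_continuous
        bounded_clinear_compose[OF bounded_clinear_U S] bounded_clinear_compose[OF C bounded_clinear_U])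
       (simp add: U_basis)
  ultimately show ?thesis
    unfolding restriction_equiv_def by blast
qed

lemma restriction_equiv_isometry: "restriction_equiv U K a (cadjoint l2_shift \<otimes>\<^sub>o\<^sub>p id)"
  unfolding shift_tensor_id
proof (rule restriction_equiv_U[OF bounded_clinear(1) bounded_clinear_l2_right_shift])
  fix l \<eta> assume \<eta>: "\<eta> \<in> range P"
  show "a ((a ^^ l) \<eta>) \<in> K"
    using in_K[OF \<eta>, of "Suc l"] by simp
  show "U (a ((a ^^ l) \<eta>)) = l2_right_shift (l2_basis l \<otimes>\<^sub>e \<eta>)"
    using U_basis[OF \<eta>, of "Suc l"] by (simp add: l2_right_shift_tens l2_right_shift_basis)
qed

section \<open>Operators commuting with the isometry up to a scalar, and the unitary part\<close>

lemma funpow_twist: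
  assumes "bounded_clinear T" "\<And>x. T (a x) = c *\<^sub>C a (T x)"
  shows "T ((a ^^ k) x) = (c ^ k) *\<^sub>C (a ^^ k) (T x)"
  by (induction k)
     (simp_all add: assms(2) linear_simps scaleC_scaleC scaleC_one)

lemma H0_eq: "H0 = (\<Inter>k\<in>{0<..}. range (a ^^ k))"
  by (auto simp: H0_def unitary_part_def)

lemma H0_invariant:
  assumes T: "bounded_clinear T" "\<And>x. T (a x) = c *\<^sub>C a (T x)" and h: "h \<in> H0"
  shows "T h \<in> H0"
proof -
  have "T h \<in> range (a ^^ k)" if "k > 0" for k
  proof -
    have "h \<in> range (a ^^ k)"
      using h that by (simp add: H0_eq)
    then obtain x where "h = (a ^^ k) x"
      by blast
    then have "T h = (a ^^ k) ((c ^ k) *\<^sub>C T x)"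
      by (simp add: funpow_twist[OF T] bounded_clinear_simps bounded_clinear_funpow bounded_clinear)
    then show ?thesis
      by blast
  qed
  then show ?thesis
    by (simp add: H0_eq)
qed

text \<open>Injectivity of \<open>a\<close> cancels one factor: from \<open>h\<close> in the range
  of power \<open>Suc k\<close> it follows that \<open>h'\<close> lies in the range of power
  \<open>k\<close>. Hence \<open>a\<close> maps the unitary part onto itself.\<close>

lemma H0_preimage:
  assumes "h \<in> H0"
  obtains h' where "h' \<in> H0" "h = a h'"
proof -
  obtain h' where h': "h = a h'"
    using assms by (auto simp: H0_def unitary_part_def dest: spec[of _ 1])
  have "h' \<in> range (a ^^ k)" if "k > 0" for k
  proof -
    have "h \<in> range (a ^^ Suc k)"
      using assms unfolding H0_eq by blast
    then obtain x where "h = a ((a ^^ k) x)"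
      by auto
    then show ?thesis
      using inj h' by blast
  qed
  then have "h' \<in> H0"
    unfolding H0_eq by blast
  then show ?thesis
    using that h' by blast
qed

lemma csubspace_H0: "csubspace H0" and closed_H0: "closed H0"
proof -
  have lin: "bounded_clinear (a ^^ k)" for k
    by (intro bounded_clinear_funpow bounded_clinear)
  have norm: "norm ((a ^^ k) x) = norm x" for k x
    by (induction k) (simp_all add: norm_isometry)
  show "csubspace H0"
    unfolding H0_eq
    by (intro complex_vector.subspace_Inter) (auto intro!: csubspace_image lin)
  show "closed H0"
    unfolding H0_eq
    by (intro closed_INT ballI closed_isometric_image lin norm) simp_all
qed

text \<open>The issue is surjectivity. A vector of \<open>H0\<close> is \<open>a h'\<close> with
  \<open>h'\<close> in \<open>H0\<close>, and \<open>fact\<close> rewrites it as \<open>T\<close> of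
  a multiple of \<open>R h'\<close>, which is in \<open>H0\<close> because \<open>R\<close> also
  preserves that space.\<close>

lemma unitary_on_H0:
  assumes T: "isometry T T'" and comm: "\<And>x. T (a x) = c *\<^sub>C a (T x)"
    and R: "bounded_clinear R" "\<And>x. R (a x) = d *\<^sub>C a (R x)"
    and fact: "\<And>x. a x = z *\<^sub>C T (R x)"
  shows "unitary_on H0 T"
proof -
  interpret T: isometry T T' by fact
  have "h \<in> T ` H0" if h: "h \<in> H0" for h
  proof -
    obtain h' where h': "h' \<in> H0" "h = a h'"
      using H0_preimage[OF h] .
    then have "h = T (z *\<^sub>C R h')"
      by (simp add: fact T.linear_simps)
    moreover have "z *\<^sub>C R h' \<in> H0"
      by (intro complex_vector.subspace_scale csubspace_H0 H0_invariant[OF R] h')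
    ultimately show ?thesis
      by blast
  qed
  moreover have "T ` H0 \<subseteq> H0"
    using H0_invariant[OF T.bounded_clinear(1) comm] by blast
  ultimately have "T ` H0 = H0"
    by blast
  then show ?thesis
    unfolding unitary_between_def
    by (simp add: csubspace_H0 closed_H0 T.linear_simps T.cinner_left T.left_inverse)
qed

lemma unitary_on_H0_self: "unitary_on H0 a"
  by (rule unitary_on_H0[OF isometry_axioms, where c = 1 and R = id and d = 1 and z = 1])
     (simp_all add: scaleC_one bounded_clinear_id)

end

section \<open>Words in the generators\<close>

declare upt_Suc [simp del]

locale B_representation = unital_cstar_algebra B
  for B :: "'a cstar_algebra" (structure) +
  fixes m n :: nat and \<theta> :: "nat \<Rightarrow> nat \<Rightarrow> real" and s :: "nat \<Rightarrow> 'a"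
    and \<pi> :: "'a \<Rightarrow> 'h \<Rightarrow> 'h::complex_hilbert"
  assumes relations: "B_relations m n \<theta> B s"
    and representation: "unital_representation B \<pi>"
begin

text \<open>Extends the twist scalars to all pairs of indices, so that \<open>s j s k\<close> is
  \<open>mu j k\<close> times \<open>s k s j\<close> in either order.\<close>

definition mu :: "nat \<Rightarrow> nat \<Rightarrow> complex" where
  "mu j k = (if j < k then twist \<theta> j k else if k < j then cnj (twist \<theta> k j) else 1)"

definition word :: "nat list \<Rightarrow> 'h \<Rightarrow> 'h"
  where "word xs = \<pi> (list_prod B (map s xs))"

definition word_adj :: "nat list \<Rightarrow> 'h \<Rightarrow> 'h"
  where "word_adj xs = \<pi> (adj B (list_prod B (map s xs)))"

text \<open>The unqualified ring facts of the locale are those of \<open>complex_ring\<close>, not of \<open>B\<close>.\<close>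

lemmas B_simprules = ring.ring_simprules[OF unital_cstar_algebra.axioms(1)[OF unital_cstar_algebra_axioms]]

lemma s_closed: "k \<in> {1..m+n} \<Longrightarrow> s k \<in> carrier B"
  using relations by (simp add: B_relations_def)

lemma rep_add: "x \<in> carrier B \<Longrightarrow> y \<in> carrier B \<Longrightarrow> \<pi> (x \<oplus> y) h = \<pi> x h + \<pi> y h"
  and rep_mult: "x \<in> carrier B \<Longrightarrow> y \<in> carrier B \<Longrightarrow> \<pi> (x \<otimes> y) h = \<pi> x (\<pi> y h)"
  and rep_smult: "x \<in> carrier B \<Longrightarrow> \<pi> (c \<odot>\<^bsub>B\<^esub> x) h = c *\<^sub>C \<pi> x h"
  and rep_one: "\<pi> \<one> h = h"
  and rep_bounded_clinear: "x \<in> carrier B \<Longrightarrow> bounded_clinear (\<pi> x)"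
  using representation by (simp_all add: unital_representation_def)

lemma rep_minus:
  assumes "x \<in> carrier B" "y \<in> carrier B"
  shows "\<pi> (x \<ominus> y) h = \<pi> x h - \<pi> y h"
proof -
  have "\<pi> ((x \<ominus> y) \<oplus> y) h = \<pi> (x \<ominus> y) h + \<pi> y h"
    using assms by (intro rep_add) simp_all
  moreover have "(x \<ominus> y) \<oplus> y = x"
    using assms by (simp add: B_simprules)
  ultimately show ?thesis
    by (simp add: algebra_simps)
qed

lemma rep_adjoint: "x \<in> carrier B \<Longrightarrow> adjoint_pair (\<pi> x) (\<pi> (adj B x))"
  using representation adj_closed
  by (simp add: adjoint_pair_def unital_representation_def)

lemma list_prod_closed: "set xs \<subseteq> {1..m+n} \<Longrightarrow> list_prod B (map s xs) \<in> carrier B"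
  by (induction xs) (auto simp: list_prod_def s_closed)

lemma word_Nil: "word [] h = h"
  by (simp add: word_def list_prod_def rep_one)

lemma word_Cons: "set (k # xs) \<subseteq> {1..m+n} \<Longrightarrow> word (k # xs) h = \<pi> (s k) (word xs h)"
  using list_prod_closed[of xs] s_closed[of k] rep_mult by (simp add: word_def list_prod_def)

lemma word_adj_Cons:
  "set (k # xs) \<subseteq> {1..m+n} \<Longrightarrow> word_adj (k # xs) h = word_adj xs (\<pi> (adj B (s k)) h)"
  using list_prod_closed[of xs] s_closed[of k] rep_mult adj_mult adj_closed
  by (simp add: word_adj_def list_prod_def)

lemma word_append:
  "set (xs @ ys) \<subseteq> {1..m+n} \<Longrightarrow> word (xs @ ys) h = word xs (word ys h)"
  by (induction xs) (simp_all add: word_Nil word_Cons)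

lemma isometry_generator:
  assumes "k \<in> {1..m+n}"
  shows "isometry (\<pi> (s k)) (\<pi> (adj B (s k)))"
proof
  show "adjoint_pair (\<pi> (s k)) (\<pi> (adj B (s k)))"
    by (rule rep_adjoint[OF s_closed[OF assms]])
  have "\<pi> (adj B (s k) \<otimes> s k) x = x" for x
    using relations assms by (simp add: B_relations_def rep_one)
  then show "\<pi> (adj B (s k)) (\<pi> (s k) x) = x" for x
    by (simp add: rep_mult s_closed[OF assms] adj_closed)
qed

lemma unitary_generator:
  assumes "k \<in> {1..m}"
  shows "\<pi> (s k) (\<pi> (adj B (s k)) x) = x"
proof -
  have "\<pi> (s k \<otimes> adj B (s k)) x = x"
    using relations assms by (simp add: B_relations_def rep_one)
  moreover have "s k \<in> carrier B"
    using assms by (intro s_closed) simp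
  ultimately show ?thesis
    by (simp add: rep_mult adj_closed)
qed

lemma isometry_word:
  assumes "set xs \<subseteq> {1..m+n}"
  shows "isometry (word xs) (word_adj xs)"
proof
  show "adjoint_pair (word xs) (word_adj xs)"
    unfolding word_def word_adj_def by (rule rep_adjoint[OF list_prod_closed[OF assms]])
  show "word_adj xs (word xs x) = x" for x
    using assms
  proof (induction xs)
    case Nil
    have "adj B \<one> = \<one>"
      by (metis adj_adj adj_closed adj_mult B_simprules)
    then show ?case
      by (simp add: word_def word_adj_def list_prod_def rep_one)
  next
    case (Cons k xs)
    then show ?case
      using isometry.left_inverse[OF isometry_generator[of k]]
      by (simp add: word_Cons word_adj_Cons)
  qed
qed

lemma unitary_word:
  assumes "set xs \<subseteq> {1..m}"
  shows "word xs (word_adj xs x) = x"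
  using assms
proof (induction xs arbitrary: x)
  case Nil
  then show ?case
    using isometry.left_inverse[OF isometry_word[of "[]"], of x] by (simp add: word_Nil)
next
  case (Cons k xs)
  then have "set (k # xs) \<subseteq> {1..m+n}"
    by auto
  with Cons show ?case
    by (simp add: word_Cons word_adj_Cons unitary_generator)
qed

lemma generator_twist:
  assumes "j \<in> {1..m+n}" "k \<in> {1..m+n}"
  shows "\<pi> (s j) (\<pi> (s k) h) = mu j k *\<^sub>C \<pi> (s k) (\<pi> (s j) h)"
proof -
  have less: "\<pi> (s j) (\<pi> (s k) h) = twist \<theta> j k *\<^sub>C \<pi> (s k) (\<pi> (s j) h)"
    if "1 \<le> j" "j < k" "k \<le> m + n" for j k
  proof -
    have "s j \<otimes> s k = twist \<theta> j k \<odot>\<^bsub>B\<^esub> (s k \<otimes> s j)"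
      using relations that by (simp add: B_relations_def)
    then have "\<pi> (s j \<otimes> s k) h = \<pi> (twist \<theta> j k \<odot>\<^bsub>B\<^esub> (s k \<otimes> s j)) h"
      by simp
    then show ?thesis
      using that s_closed by (simp add: rep_mult rep_smult)
  qed
  \<comment> \<open>This inverts the defining relation, which is stated only for increasing
    indices.\<close>
  have "cnj (twist \<theta> k j) * twist \<theta> k j = 1"
    using complex_norm_square[of "twist \<theta> k j"] by (simp add: cmod_twist mult.commute)
  then show ?thesis
    using less[of j k] less[of k j] assms
    by (cases j k rule: linorder_cases) (simp_all add: mu_def scaleC_scaleC scaleC_one)
qed

lemma cmod_mu: "cmod (mu j k) = 1"
  by (simp add: mu_def cmod_twist)

lemma generator_word:
  assumes "k \<in> {1..m+n}" "set xs \<subseteq> {1..m+n}"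
  shows "\<pi> (s k) (word xs h) = prod_list (map (mu k) xs) *\<^sub>C word xs (\<pi> (s k) h)"
  using assms(2)
proof (induction xs)
  case Nil
  then show ?case
    by (simp add: word_Nil scaleC_one)
next
  case (Cons j xs)
  then show ?case
    using bounded_clinear_simps(5)[OF rep_bounded_clinear[OF s_closed[of j]]]
    by (simp add: word_Cons generator_twist[OF assms(1)] scaleC_scaleC)
qed

text \<open>The first letter \<open>k\<close> of the left word occurs somewhere in
  \<open>ys\<close>. Moving it through the letters in front of that place costs a unimodular scalar,
  and the rest is induction.\<close>

lemma word_permute:
  assumes "mset xs = mset ys" "set ys \<subseteq> {1..m+n}"
  shows "\<exists>z. cmod z = 1 \<and> (\<forall>h. word xs h = z *\<^sub>C word ys h)"
  using assms
proof (induction xs arbitrary: ys)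
  case Nil
  then show ?case
    by (intro exI[of _ 1]) (simp add: scaleC_one)
next
  case (Cons k xs)
  have sub: "set (k # xs) \<subseteq> {1..m+n}"
    using Cons.prems by (metis set_mset_mset)
  have "k \<in> set ys"
    using Cons.prems(1) by (metis list.set_intros(1) set_mset_mset)
  then obtain ys1 ys2 where ys: "ys = ys1 @ k # ys2"
    by (meson split_list)
  then have "mset xs = mset (ys1 @ ys2)" and sub_ys: "set ys1 \<union> set ys2 \<subseteq> {1..m+n}"
    using Cons.prems by simp_all
  then obtain z where z: "cmod z = 1" "\<And>h. word xs h = z *\<^sub>C word (ys1 @ ys2) h"
    using Cons.IH[of "ys1 @ ys2"] by auto
  let ?w = "prod_list (map (mu k) ys1)"
  have k: "k \<in> {1..m+n}"
    using sub by simp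
  note lin = bounded_clinear_simps(5)[OF rep_bounded_clinear[OF s_closed[OF k]]]
  have "word (k # xs) h = (z * ?w) *\<^sub>C word ys h" for h
    using sub sub_ys k
    by (simp add: ys word_Cons z(2) lin word_append generator_word scaleC_scaleC)
  moreover have "cmod (z * ?w) = 1"
    by (simp add: norm_mult z(1) cmod_prod_list_eq_1 cmod_mu)
  ultimately show ?case
    by blast
qed

definition all :: "nat list" where "all = [1..<Suc (m + n)]"

lemma set_all: "set all = {1..m+n}"
  by (auto simp: all_def)

lemma distinct_all: "distinct all"
  by (simp add: all_def)

sublocale wold "word all" "word_adj all"
  by (intro wold.intro isometry_word) (simp add: set_all)

lemma all_split:
  assumes "k \<in> {1..m+n}"
  shows "all = [1..<k] @ k # [k+1..<Suc (m+n)]"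
  using assms upt_add_eq_append[of 1 k "Suc (m+n) - k"] upt_conv_Cons[of k "Suc (m+n)"]
  by (simp add: all_def)

lemma mu_below: "map (mu k) [1..<k] = map (\<lambda>i. cnj (twist \<theta> i k)) [1..<k]"
  by (auto simp: mu_def)

text \<open>Smaller indices contribute conjugate twists, larger ones twists, and \<open>k\<close>
  itself contributes \<open>1\<close>. This is the origin of the diagonal operators in the formulas
  for the generators on \<open>K\<close>.\<close>

lemma generator_all:
  assumes "k \<in> {1..m+n}"
  shows "\<pi> (s k) (word all h) = twist_factor \<theta> (m + n) k *\<^sub>C word all (\<pi> (s k) h)"
proof -
  have "map (mu k) [k+1..<Suc (m+n)] = map (twist \<theta> k) [k+1..<Suc (m+n)]"
    by (auto simp: mu_def)
  moreover have "map (mu k) all = map (mu k) [1..<k] @ mu k k # map (mu k) [k+1..<Suc (m+n)]"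
    unfolding all_split[OF assms] by simp
  ultimately have "prod_list (map (mu k) all) = twist_factor \<theta> (m + n) k"
    by (simp only: twist_factor_def mu_below prod_list.append prod_list.Cons) (simp add: mu_def)
  then show ?thesis
    using generator_word[OF assms, of all h] set_all by simp
qed

end

section \<open>Complementary words\<close>

text \<open>
  For \<open>Q_all\<close> the list \<open>zs\<close> is empty; for \<open>Q_isom\<close> it consists of the indices of the unitary
  generators that are missing, which do not affect the defect projection.
\<close>

locale complementary_word = B_representation +
  fixes i :: nat and qs zs :: "nat list" and Q :: "nat \<Rightarrow> 'a"
  assumes i: "i \<in> {1..m+n}"
    and zs: "set zs \<subseteq> {1..m}"
    and split: "mset (i # qs @ zs) = mset all"
    and Q: "Q i = list_prod B (map s qs)"
begin

lemma qs: "set qs \<subseteq> {1..m+n}"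
  using split set_all by (metis list.set(2) set_append set_mset_mset subset_insertI2 sup_ge1)

sublocale pair: isometry_pair "\<pi> (s i)" "\<pi> (adj B (s i))" "word qs" "word_adj qs"
  "prod_list (map (mu i) qs)"
proof (intro isometry_pair.intro isometry_generator isometry_word isometry_pair_axioms.intro)
  show "cmod (prod_list (map (mu i) qs)) = 1"
    by (simp add: cmod_prod_list_eq_1 cmod_mu)
  show "\<pi> (s i) (word qs x) = prod_list (map (mu i) qs) *\<^sub>C word qs (\<pi> (s i) x)" for x
    by (rule generator_word[OF i qs])
qed (fact i qs)+

lemma all_factorization:
  "\<exists>z. cmod z = 1 \<and> (\<forall>h. word all h = z *\<^sub>C \<pi> (s i) (word qs (word zs h)))"
proof -
  have sub: "set (i # qs @ zs) \<subseteq> {1..m+n}"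
    using i qs zs by auto
  then have "\<exists>z. cmod z = 1 \<and> (\<forall>h. word all h = z *\<^sub>C word (i # qs @ zs) h)"
    by (rule word_permute[OF split[symmetric]])
  then show ?thesis
    using sub by (auto simp: word_Cons word_append)
qed

text \<open>In the range projection of \<open>word all\<close> the scalar \<open>z\<close> meets its
  conjugate, and \<open>word zs\<close> meets its adjoint and cancels, being a product of unitaries.
  What remains is the range projection of \<open>\<pi> (s i)\<close> followed by
  \<open>word qs\<close> on its right.\<close>

lemma defect_eq: "pair.defect = P"
proof
  fix x
  obtain z where z: "cmod z = 1" "\<And>h. word all h = z *\<^sub>C \<pi> (s i) (word qs (word zs h))"
    using all_factorization by blast
  interpret Z: isometry "word zs" "word_adj zs"
    using zs by (intro isometry_word) auto
  have adj: "word_adj all x = cnj z *\<^sub>C word_adj zs (word_adj qs (\<pi> (adj B (s i)) x))"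
  proof (rule cinner_ext)
    fix h
    have "cinner h (word_adj all x) = cinner (word all h) x"
      by (rule cinner_left[symmetric])
    then show "cinner h (word_adj all x) =
        cinner h (cnj z *\<^sub>C word_adj zs (word_adj qs (\<pi> (adj B (s i)) x)))"
      unfolding z(2)
      by (simp add: cinner_scaleC_left cinner_scaleC_right pair.V.cinner_left
          pair.W.cinner_left Z.cinner_left)
  qed
  have "z * cnj z = 1"
    using complex_norm_square[of z] z(1) by simp
  then have "word all (word_adj all x) = \<pi> (s i) (word qs (word_adj qs (\<pi> (adj B (s i)) x)))"
    unfolding adj linear_simps unfolding z(2)
    by (simp add: unitary_word[OF zs] scaleC_scaleC mult.commute)
  then show "pair.defect x = P x"
    by (simp add: pair.defect_def P_def)
qed

lemma u_eq: "\<pi> (u_elem B s Q i) = pair.u"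
  and p_eq: "\<pi> (P_elem B s Q i) = pair.p"
proof -
  have c: "s i \<in> carrier B" "Q i \<in> carrier B" "adj B (s i) \<in> carrier B" "adj B (Q i) \<in> carrier B"
    using s_closed[OF i] list_prod_closed[OF qs] by (simp_all add: Q adj_closed)
  have w: "\<pi> (Q i) = word qs" "\<pi> (adj B (Q i)) = word_adj qs"
    by (simp_all add: Q word_def word_adj_def)
  show "\<pi> (u_elem B s Q i) = pair.u" "\<pi> (P_elem B s Q i) = pair.p"
    by (rule ext; simp add: u_elem_def P_elem_def pair.u_def pair.p_def rep_add rep_mult
      rep_minus rep_one c w)+
qed

lemma commutes_unitary_projection:
  "P \<circ> \<pi> (u_elem B s Q i) = \<pi> (u_elem B s Q i) \<circ> P"
  "P \<circ> \<pi> (P_elem B s Q i) = \<pi> (P_elem B s Q i) \<circ> P"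
  "unitary_on (range P) (\<pi> (u_elem B s Q i))"
  "projection_on (range P) (\<pi> (P_elem B s Q i))"
  unfolding u_eq p_eq defect_eq[symmetric]
  by (simp_all add: fun_eq_iff pair.defect_u pair.u_defect pair.defect_p pair.p_defect
      pair.unitary_u pair.projection_p)

lemma generator_unitary_on_H0:
  assumes "zs = []"
  shows "unitary_on H0 (\<pi> (s i))"
proof -
  obtain z where z: "cmod z = 1" "\<And>h. word all h = z *\<^sub>C \<pi> (s i) (word qs (word zs h))"
    using all_factorization by blast
  have z0: "z \<noteq> 0"
    using z(1) by auto
  let ?c = "twist_factor \<theta> (m + n) i"
  have c0: "?c \<noteq> 0"
    using cmod_twist_factor by (metis norm_zero zero_neq_one)
  have fact: "word all x = z *\<^sub>C \<pi> (s i) (word qs x)" for x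
    unfolding z(2) assms word_Nil ..
  \<comment> \<open>Instead of multiplying out the twists of all letters of \<open>qs\<close>,
    cancel the injective \<open>\<pi> (s i)\<close>: its product with \<open>word qs\<close> is a
    multiple of \<open>word all\<close> and so commutes with \<open>word all\<close>.\<close>
  have R: "word qs (word all x) = inverse ?c *\<^sub>C word all (word qs x)" for x
  proof (rule pair.V.inj)
    have "z *\<^sub>C \<pi> (s i) (word qs (word all x)) = word all (z *\<^sub>C \<pi> (s i) (word qs x))"
      by (simp flip: fact)
    also have "\<dots> = z *\<^sub>C (inverse ?c *\<^sub>C \<pi> (s i) (word all (word qs x)))"
      using c0 by (simp add: linear_simps generator_all[OF i] scaleC_scaleC scaleC_one)
    finally show "\<pi> (s i) (word qs (word all x)) = \<pi> (s i) (inverse ?c *\<^sub>C word all (word qs x))"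
      using z0 by (simp only: complex_vector.scale_cancel_left pair.V.linear_simps) simp
  qed
  show ?thesis
    by (rule unitary_on_H0[OF pair.V.isometry_axioms generator_all[OF i]
          pair.W.bounded_clinear(1) R fact])
qed

text \<open>On the defect space the unitary generator coincides with \<open>u\<close>; moving it
  past \<open>l\<close> copies of \<open>word all\<close> gives the power of
  \<open>twist_factor\<close> that \<open>diag_op\<close> has at \<open>l\<close>.\<close>

lemma restriction_equiv_unitary:
  assumes "i \<le> m"
  shows "restriction_equiv U K (\<pi> (s i)) (diag_op \<theta> (m + n) i \<otimes>\<^sub>o\<^sub>p \<pi> (u_elem B s Q i))"
proof (rule restriction_equiv_U)
  note u = pair.bounded_clinear_u[folded u_eq]
  show "bounded_clinear (diag_op \<theta> (m + n) i \<otimes>\<^sub>o\<^sub>p \<pi> (u_elem B s Q i))"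
    by (rule bounded_clinear_diag_op_tensor[OF u])
  fix l \<eta> assume \<eta>: "\<eta> \<in> range P"
  let ?c = "twist_factor \<theta> (m + n) i ^ l" and ?u = "\<pi> (u_elem B s Q i) \<eta>"
  have "\<pi> (s i) \<eta> = ?u"
    unfolding u_eq using \<eta> i assms
    by (intro pair.unitary_decomposition unitary_generator) (simp_all add: defect_eq)
  then have eq: "\<pi> (s i) ((word all ^^ l) \<eta>) = ?c *\<^sub>C (word all ^^ l) ?u"
    by (simp add: funpow_twist[OF pair.V.bounded_clinear(1) generator_all[OF i]])
  have mem: "?u \<in> range P"
    using pair.u_in_range[of \<eta>] unfolding u_eq defect_eq .
  show "\<pi> (s i) ((word all ^^ l) \<eta>) \<in> K"
    unfolding eq by (intro complex_vector.subspace_scale csubspace_K in_K mem)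
  show "U (\<pi> (s i) ((word all ^^ l) \<eta>)) =
      (diag_op \<theta> (m + n) i \<otimes>\<^sub>o\<^sub>p \<pi> (u_elem B s Q i)) (l2_basis l \<otimes>\<^sub>e \<eta>)"
    unfolding eq diag_op_tensor_basis[OF u]
    by (simp add: bounded_clinear_simps[OF bounded_clinear_U] U_basis[OF mem])
qed (rule pair.V.bounded_clinear)

text \<open>The summand of \<open>decomposition\<close> coming from \<open>p\<close> contains a
  further factor \<open>word all\<close> and so climbs from level \<open>l\<close> to
  \<open>Suc l\<close>; the other summand stays at level \<open>l\<close>.\<close>

lemma restriction_equiv_isometry_generator:
  assumes qs_all: "qs = filter (\<lambda>j. j \<noteq> i) all"
  defines "u \<equiv> \<pi> (u_elem B s Q i)" and "p \<equiv> \<pi> (P_elem B s Q i)"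
  shows "restriction_equiv U K (\<pi> (s i))
    (\<lambda>f. ((\<lambda>x. (\<Prod>j=1..<i. cnj (twist \<theta> j i)) *\<^sub>C cadjoint l2_shift (diag_op \<theta> (m + n) i x))
        \<otimes>\<^sub>o\<^sub>p (u \<circ> p)) f +
      (diag_op \<theta> (m + n) i \<otimes>\<^sub>o\<^sub>p (u \<circ> (\<lambda>h. h - p h))) f)"
    (is "restriction_equiv U K _ (\<lambda>f. ?C1 f + ?C2 f)")
proof (rule restriction_equiv_U)
  let ?z = "\<Prod>j=1..<i. cnj (twist \<theta> j i)"
  have lin: "bounded_clinear u" "bounded_clinear p"
    unfolding u_def p_def u_eq p_eq by (rule pair.bounded_clinear_u pair.bounded_clinear_p)+
  have up: "bounded_clinear (u \<circ> p)"
    by (intro bounded_clinear_comp lin)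
  have uq: "bounded_clinear (u \<circ> (\<lambda>h. h - p h))"
    by (intro bounded_clinear_comp bounded_clinear_sub bounded_clinear_ident lin)
  show "bounded_clinear (\<lambda>f. ?C1 f + ?C2 f)"
    by (intro bounded_clinear_add bounded_clinear_shift_diag_op_tensor[OF up]
        bounded_clinear_diag_op_tensor[OF uq])
  \<comment> \<open>The letter \<open>i\<close> in front of \<open>qs\<close> moves past the smaller
    indices into its own place, which completes the full product and yields the conjugate twists in
    \<open>?z\<close>.\<close>
  have "qs = [1..<i] @ [i+1..<Suc (m+n)]"
    unfolding qs_all all_split[OF i] by (simp add: filter_id_conv)
  then have "\<pi> (s i) (word qs x) = prod_list (map (mu i) [1..<i]) *\<^sub>C word all x" for x
    using i qs unfolding all_split[OF i]
    by (simp add: word_append word_Cons generator_word)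
  moreover have "prod_list (map (mu i) [1..<i]) = ?z"
    unfolding mu_below by (simp flip: prod.distinct_set_conv_list)
  ultimately have fact: "\<pi> (s i) (word qs x) = ?z *\<^sub>C word all x" for x
    by simp
  fix l \<eta> assume \<eta>: "\<eta> \<in> range P"
  let ?c = "twist_factor \<theta> (m + n) i ^ l"
  have "\<pi> (s i) \<eta> = ?z *\<^sub>C word all (u (p \<eta>)) + u (\<eta> - p \<eta>)"
    unfolding u_def p_def u_eq p_eq fact[symmetric]
    using \<eta> by (intro pair.decomposition) (simp add: defect_eq)
  \<comment> \<open>The weight is the power \<open>l\<close> also in the summand at level
    \<open>Suc l\<close>: only \<open>l\<close> copies of \<open>word all\<close> are passed. This
    matches \<open>diag_op\<close> acting before the shift.\<close>
  then have eq: "\<pi> (s i) ((word all ^^ l) \<eta>) =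
      (?z * ?c) *\<^sub>C (word all ^^ Suc l) (u (p \<eta>)) + ?c *\<^sub>C (word all ^^ l) (u (\<eta> - p \<eta>))"
    unfolding funpow_twist[OF pair.V.bounded_clinear(1) generator_all[OF i]]
    by (simp add: bounded_clinear_simps[OF bounded_clinear_funpow[OF bounded_clinear(1)]]
        scaleC_add_right scaleC_scaleC funpow_swap1 mult.commute)
  have mem: "u x \<in> range P" for x
    using pair.u_in_range[of x] unfolding u_def u_eq defect_eq .
  show "\<pi> (s i) ((word all ^^ l) \<eta>) \<in> K"
    unfolding eq
    by (intro complex_vector.subspace_add complex_vector.subspace_scale csubspace_K in_K mem)
  show "U (\<pi> (s i) ((word all ^^ l) \<eta>)) = ?C1 (l2_basis l \<otimes>\<^sub>e \<eta>) + ?C2 (l2_basis l \<otimes>\<^sub>e \<eta>)"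
    unfolding eq diag_op_tensor_basis[OF uq] shift_diag_op_tensor_basis[OF up]
    unfolding bounded_clinear_simps[OF bounded_clinear_U] U_basis[OF mem] by simp
qed (rule pair.V.bounded_clinear)

end

section \<open>The two choices of the complementary product, and the proposition\<close>

context B_representation
begin

lemma complementary_word_Q_all:
  assumes "i \<in> {1..m+n}"
  shows "complementary_word B m n \<theta> s \<pi> i (filter (\<lambda>j. j \<noteq> i) all) [] (Q_all m n B s)"
proof (intro complementary_word.intro complementary_word_axioms.intro B_representation_axioms)
  have "set (i # filter (\<lambda>j. j \<noteq> i) all) = set all"
    using assms unfolding set_all[symmetric] by auto
  then show "mset (i # filter (\<lambda>j. j \<noteq> i) all @ []) = mset all"
    by (subst set_eq_iff_mset_eq_distinct[symmetric]) (simp_all add: distinct_all)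
qed (use assms in \<open>simp_all add: Q_all_def omit_prod_def all_def\<close>)

text \<open>One pair of filtered lists serves both cases: \<open>i\<close> is omitted from the list
  of missing unitary letters if \<open>i \<le> m\<close>, and from the letters of
  \<open>Q_isom\<close> otherwise.\<close>

lemma complementary_word_Q_isom:
  assumes "i \<in> {1..m+n}"
  shows "complementary_word B m n \<theta> s \<pi> i (filter (\<lambda>j. j \<noteq> i) [m+1..<Suc (m+n)])
    (filter (\<lambda>j. j \<noteq> i) [1..<Suc m]) (Q_isom m n B s)"
proof (intro complementary_word.intro complementary_word_axioms.intro B_representation_axioms)
  have "set (i # filter (\<lambda>j. j \<noteq> i) [m+1..<Suc (m+n)] @ filter (\<lambda>j. j \<noteq> i) [1..<Suc m]) = set all"
    using assms by (auto simp: set_all)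
  moreover have "distinct (i # filter (\<lambda>j. j \<noteq> i) [m+1..<Suc (m+n)] @
      filter (\<lambda>j. j \<noteq> i) [1..<Suc m])"
    by auto
  ultimately show "mset (i # filter (\<lambda>j. j \<noteq> i) [m+1..<Suc (m+n)] @ filter (\<lambda>j. j \<noteq> i) [1..<Suc m]) =
      mset all"
    using set_eq_iff_mset_eq_distinct distinct_all by blast
qed (use assms in \<open>auto simp: Q_isom_def omit_prod_def\<close>)

end

theorem proposition4p8:
  fixes m n :: nat and \<theta> :: "nat \<Rightarrow> nat \<Rightarrow> real"
    and B :: "'a cstar_algebra" and s :: "nat \<Rightarrow> 'a"
    and \<pi> :: "'a \<Rightarrow> 'h \<Rightarrow> 'h::complex_hilbert"
    and \<alpha> P :: "'h \<Rightarrow> 'h" and H0 K PH :: "'h set"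
  assumes "m + n > 1"
    and "universal_B m n \<theta> B s"
    and "separable_space (euclidean :: 'h topology)"
    and "unital_representation B \<pi>"
  defines "\<alpha> \<equiv> \<pi> (list_prod B (map s [1..<Suc (m + n)]))"
    and "P \<equiv> defect_projection \<alpha>"
    and "PH \<equiv> range P"
    and "H0 \<equiv> unitary_part \<alpha>"
    and "K \<equiv> shift_part \<alpha>"
  shows "\<exists>U :: 'h \<Rightarrow> 'h l2.
    unitary_between K (l2_tensor PH) U \<and>
    (\<forall>l. \<forall>\<eta>\<in>PH. U ((\<alpha> ^^ l) \<eta>) = l2_basis l \<otimes>\<^sub>e \<eta>) \<and>
    \<comment> \<open>(i)\<close>
    unitary_on H0 \<alpha> \<and>
    restriction_equiv U K \<alpha> (cadjoint l2_shift \<otimes>\<^sub>o\<^sub>p id) \<and>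
    \<comment> \<open>(ii)\<close>
    (\<forall>i\<in>{1..m+n}. unitary_on H0 (\<pi> (s i))) \<and>
    \<comment> \<open>(iii)\<close>
    (\<forall>Q\<in>{Q_isom m n B s, Q_all m n B s}. \<forall>i\<in>{1..m+n}.
      P \<circ> \<pi> (u_elem B s Q i) = \<pi> (u_elem B s Q i) \<circ> P \<and>
      P \<circ> \<pi> (P_elem B s Q i) = \<pi> (P_elem B s Q i) \<circ> P \<and>
      unitary_on PH (\<pi> (u_elem B s Q i)) \<and>
      projection_on PH (\<pi> (P_elem B s Q i))) \<and>
    \<comment> \<open>(iv)\<close>
    (\<forall>Q\<in>{Q_isom m n B s, Q_all m n B s}. \<forall>k\<in>{1..m}.
      restriction_equiv U K (\<pi> (s k)) (diag_op \<theta> (m + n) k \<otimes>\<^sub>o\<^sub>p \<pi> (u_elem B s Q k))) \<and>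
    (\<forall>k\<in>{m+1..m+n}.
      let u = \<pi> (u_elem B s (Q_all m n B s) k); p = \<pi> (P_elem B s (Q_all m n B s) k) in
      restriction_equiv U K (\<pi> (s k))
        (\<lambda>f. ((\<lambda>x. (\<Prod>i=1..<k. cnj (twist \<theta> i k)) *\<^sub>C cadjoint l2_shift (diag_op \<theta> (m + n) k x))
                \<otimes>\<^sub>o\<^sub>p (u \<circ> p)) f +
             (diag_op \<theta> (m + n) k \<otimes>\<^sub>o\<^sub>p (u \<circ> (\<lambda>h. h - p h))) f))"
proof -
  interpret R: B_representation B m n \<theta> s \<pi>
    using assms(2,4)
    by (simp add: universal_B_def B_representation_def B_representation_axioms_def)
  have \<alpha>: "\<alpha> = R.word R.all"
    by (simp only: \<alpha>_def R.word_def R.all_def)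
  have sets: "P = R.P" "PH = range R.P" "H0 = R.H0" "K = R.K"
    by (simp_all only: PH_def P_def H0_def K_def \<alpha> R.defect_projection_eq R.shift_part_eq R.H0_def)
  have Q: "\<exists>qs zs. complementary_word B m n \<theta> s \<pi> i qs zs Q"
    if "Q \<in> {Q_isom m n B s, Q_all m n B s}" "i \<in> {1..m+n}" for Q i
    using that R.complementary_word_Q_all R.complementary_word_Q_isom by blast
  show ?thesis
    unfolding \<alpha> sets
  proof (intro exI[of _ R.U] conjI ballI allI R.unitary_U R.U_basis R.unitary_on_H0_self
      R.restriction_equiv_isometry)
    \<comment> \<open>\<open>Q_all\<close> is taken here because its list \<open>zs\<close> is
      empty, so that the full product is a multiple of \<open>s i\<close> times the complementary
      word.\<close>
    show "unitary_on R.H0 (\<pi> (s i))" if "i \<in> {1..m+n}" for i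
      by (rule complementary_word.generator_unitary_on_H0[OF R.complementary_word_Q_all[OF that]]) simp
  next
    fix Q i assume *: "Q \<in> {Q_isom m n B s, Q_all m n B s}" "i \<in> {1..m+n}"
    obtain qs zs where word: "complementary_word B m n \<theta> s \<pi> i qs zs Q"
      using Q[OF *] by blast
    show "R.P \<circ> \<pi> (u_elem B s Q i) = \<pi> (u_elem B s Q i) \<circ> R.P"
      "R.P \<circ> \<pi> (P_elem B s Q i) = \<pi> (P_elem B s Q i) \<circ> R.P"
      "unitary_on (range R.P) (\<pi> (u_elem B s Q i))"
      "projection_on (range R.P) (\<pi> (P_elem B s Q i))"
      by (rule complementary_word.commutes_unitary_projection[OF word])+
  next
    fix Q k assume *: "Q \<in> {Q_isom m n B s, Q_all m n B s}" "k \<in> {1..m}"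
    then obtain qs zs where word: "complementary_word B m n \<theta> s \<pi> k qs zs Q"
      using Q[of Q k] by auto
    show "restriction_equiv R.U R.K (\<pi> (s k)) (diag_op \<theta> (m + n) k \<otimes>\<^sub>o\<^sub>p \<pi> (u_elem B s Q k))"
      using * by (intro complementary_word.restriction_equiv_unitary[OF word]) simp
  next
    fix k assume "k \<in> {m+1..m+n}"
    then have "k \<in> {1..m+n}"
      by simp
    from complementary_word.restriction_equiv_isometry_generator[OF
        R.complementary_word_Q_all[OF this] refl]
    show "let u = \<pi> (u_elem B s (Q_all m n B s) k); p = \<pi> (P_elem B s (Q_all m n B s) k) in
      restriction_equiv R.U R.K (\<pi> (s k))
        (\<lambda>f. ((\<lambda>x. (\<Prod>i=1..<k. cnj (twist \<theta> i k)) *\<^sub>C cadjoint l2_shift (diag_op \<theta> (m + n) k x))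
                \<otimes>\<^sub>o\<^sub>p (u \<circ> p)) f +
             (diag_op \<theta> (m + n) k \<otimes>\<^sub>o\<^sub>p (u \<circ> (\<lambda>h. h - p h))) f)"
      by (simp only: Let_def)
  qed
qed

end
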